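(* Let $0<\varepsilon<1/3$. There exist constants $c,c'>0$ depending only on $\varepsilon$ such that for all $d\ge3$ and all $x\in\mathbb{H}=\{0,1\}^d$, \[ \mathbb{P}\big[\text{some neighbour of }x\text{ is contained in a substantial component of }\mathbb{H}\cap E_\varphi^{\ge h_{\mathrm{as}}(d)(1-2\varepsilon)}\big]\ge1-ce^{-c'd^\varepsilon}. \]
   Context: Under $\mathbb{P}$, $\varphi$ is the Gaussian free field on $\mathbb{Z}^d$ ($d\ge3$): centered Gaussian with covariance the Green function $g(x,y)=\sum_{n\ge0}P_x[X_n=y]$ of simple random walk; $h_{\mathrm{as}}(d)=\sqrt{2g(0,0)\log d}$ and $E_\varphi^{\ge h}=\{x:\varphi_x\ge h\}$. Neighbours are with respect to the nearest-neighbour graph ($|y-x|_1=1$). Let $b=b(\varepsilon)=1+11/\varepsilon$. For $K\subset\mathbb{Z}^d$, a substantial component of $K$ is a (nearest-neighbour) connected subset $C$ of $K$ containing at least $\lfloor d^\varepsilon/b\rfloor^{b-1}$ points. *)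

theory Defs
  imports "HOL-Probability.Probability"
begin

text \<open>Points of the lattice Z^d are integer lists of length d.\<close>

definition lattice :: "nat \<Rightarrow> int list set" where
  "lattice d = {x. length x = d}"

text \<open>The hypercube {0,1}^d inside Z^d.\<close>
definition hypercube :: "nat \<Rightarrow> int list set" where
  "hypercube d = {x. length x = d \<and> set x \<subseteq> {0, 1}}"

text \<open>Nearest-neighbour relation: l1-distance exactly 1.\<close>
definition nbr :: "int list \<Rightarrow> int list \<Rightarrow> bool" where
  "nbr x y \<longleftrightarrow> length x = length y \<and> (\<Sum>i<length x. \<bar>y ! i - x ! i\<bar>) = 1"

text \<open>n-step transition probability of simple random walk on Z^(length x).\<close>
fun srw_prob :: "nat \<Rightarrow> int list \<Rightarrow> int list \<Rightarrow> real" where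
  "srw_prob 0 x y = (if x = y then 1 else 0)"
| "srw_prob (Suc n) x y = (\<Sum>z\<in>{z. nbr x z}. srw_prob n z y) / (2 * real (length x))"

text \<open>Green function g(x,y) = sum over n of P_x[X_n = y].\<close>
definition green :: "int list \<Rightarrow> int list \<Rightarrow> real" where
  "green x y = (\<Sum>n. srw_prob n x y)"

definition origin :: "nat \<Rightarrow> int list" where
  "origin d = replicate d 0"

text \<open>h_as(d) = sqrt(2 g(0,0) log d).\<close>
definition h_as :: "nat \<Rightarrow> real" where
  "h_as d = sqrt (2 * green (origin d) (origin d) * ln (real d))"

text \<open>Nearest-neighbour connectedness of a set of lattice points.\<close>
definition nn_connected :: "int list set \<Rightarrow> bool" where
  "nn_connected C \<longleftrightarrow>
     (\<forall>x\<in>C. \<forall>y\<in>C. (x, y) \<in> {(u, v). u \<in> C \<and> v \<in> C \<and> nbr u v}\<^sup>*)"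

text \<open>b(eps) = 1 + 11/eps and substantial components.\<close>
definition bconst :: "real \<Rightarrow> real" where
  "bconst \<epsilon> = 1 + 11 / \<epsilon>"

definition substantial_comp :: "real \<Rightarrow> nat \<Rightarrow> int list set \<Rightarrow> int list set \<Rightarrow> bool" where
  "substantial_comp \<epsilon> d K C \<longleftrightarrow> C \<subseteq> K \<and> nn_connected C \<and>
     real (card C) \<ge> real_of_int \<lfloor>real d powr \<epsilon> / bconst \<epsilon>\<rfloor> powr (bconst \<epsilon> - 1)"

text \<open>Level set E^{>= h} of a field configuration.\<close>
definition level_set :: "(int list \<Rightarrow> real) \<Rightarrow> nat \<Rightarrow> real \<Rightarrow> int list set" where
  "level_set \<omega> d h = {x \<in> lattice d. \<omega> x \<ge> h}"

text \<open>P is the law of the Gaussian free field on Z^d, realised canonically on the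
  configuration space int list => real (coordinates outside Z^d are irrelevant):
  the coordinate process restricted to Z^d is a centred Gaussian process with
  covariance the Green function, expressed through characteristic functions of
  all finite linear combinations.\<close>
definition gff_law :: "nat \<Rightarrow> (int list \<Rightarrow> real) measure \<Rightarrow> bool" where
  "gff_law d P \<longleftrightarrow> prob_space P \<and> sets P = sets (Pi\<^sub>M UNIV (\<lambda>_. borel)) \<and>
     (\<forall>S a. finite S \<and> S \<subseteq> lattice d \<longrightarrow>
        (LINT \<omega>|P. iexp (\<Sum>x\<in>S. a x * \<omega> x))
          = complex_of_real (exp (- (\<Sum>x\<in>S. \<Sum>y\<in>S. a x * a y * green x y) / 2)))"

end

theory Submission
  imports Defs "HOL-Real_Asymp.Real_Asymp"
begin

text \<open>
  The function \<open>a (a + 1) / (|x - y|\<^sup>2 + a)\<close> with \<open>a = 1 / (d - 1)\<close> is a supersolution of the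
  Poisson equation with source at \<open>y\<close>, so the Green function is at most \<open>1 + a\<close> on the diagonal
  and at most \<open>a\<close> off it. The field at the cube neighbours of a cube vertex is an exchangeable
  Gaussian vector by symmetry; subtracting a suitable multiple of its sum leaves independent
  variables of variance close to 1, while the subtracted term has variance at most \<open>a\<close>.

  Let \<open>s = \<lfloor>d\<^sup>\<epsilon> / b\<rfloor>\<close> and \<open>m = \<lceil>11 / \<epsilon>\<rceil>\<close>, and cut the coordinates into \<open>(m + 1) s\<close>
  intervals of length of order \<open>d\<close> to the power \<open>1 - \<epsilon>\<close>. A value above the level has probability
  about \<open>d\<close> to the power \<open>- (1 - 2 \<epsilon>)\<^sup>2\<close>, so an interval contains no neighbour above the level
  with probability at most \<open>exp (- d\<^sup>\<gamma>)\<close> for some \<open>\<gamma> > \<epsilon>\<close>. A union bound over the polynomially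
  many vertices within distance \<open>m\<close> of \<open>x\<close> then yields an \<open>s\<close>-ary tree of depth \<open>m\<close> in the level
  set, rooted at a neighbour of \<open>x\<close>.
\<close>

section \<open>Bounds on the Green function\<close>

lemma nbr_length: "nbr x z \<Longrightarrow> length z = length x"
  by (simp add: nbr_def)

lemma nbr_update:
  assumes "i < length x" "e = 1 \<or> e = -1"
  shows "nbr x (x[i := x ! i + e])"
proof -
  have "(\<Sum>k<length x. \<bar>x[i := x ! i + e] ! k - x ! k\<bar>) = (\<Sum>k<length x. if k = i then \<bar>e\<bar> else 0)"
    by (intro sum.cong) (auto simp: nth_list_update)
  also have "\<dots> = 1" using assms by auto
  finally show ?thesis by (simp add: nbr_def)
qed

lemma nbr_eq_update:
  assumes "nbr x z"
  obtains i e where "i < length x" "e = 1 \<or> e = -1" "z = x[i := x ! i + e]"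
proof -
  have len: "length z = length x" and s: "(\<Sum>k<length x. \<bar>z ! k - x ! k\<bar>) = 1"
    using assms by (auto simp: nbr_def)
  obtain i where i: "i < length x" "z ! i \<noteq> x ! i"
    using s by (metis (mono_tags, lifting) abs_zero diff_self lessThan_iff sum.neutral zero_neq_one)
  have "(\<Sum>k<length x. \<bar>z ! k - x ! k\<bar>) = \<bar>z ! i - x ! i\<bar> + (\<Sum>k\<in>{..<length x}-{i}. \<bar>z ! k - x ! k\<bar>)"
    using i by (intro sum.remove) auto
  moreover have nn: "(\<Sum>k\<in>{..<length x}-{i}. \<bar>z ! k - x ! k\<bar>) \<ge> 0" by (intro sum_nonneg) auto
  moreover have "\<bar>z ! i - x ! i\<bar> \<ge> 1" using i by linarith
  ultimately have 1: "\<bar>z ! i - x ! i\<bar> = 1" and 0: "(\<Sum>k\<in>{..<length x}-{i}. \<bar>z ! k - x ! k\<bar>) = 0"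
    using s by linarith+
  have oth: "z ! k = x ! k" if "k < length x" "k \<noteq> i" for k
    using 0 that by (subst (asm) sum_nonneg_eq_0_iff) auto
  have "z = x[i := x ! i + (z ! i - x ! i)]"
    using len i oth by (intro nth_equalityI) (auto simp: nth_list_update)
  moreover have "z ! i - x ! i = 1 \<or> z ! i - x ! i = -1" using 1 by linarith
  ultimately show ?thesis using that i by blast
qed

text \<open>Writing neighbours as an image of (coordinate, sign) pairs lets sums over them split
  into the two-sided differences of \<open>sum_nbr\<close>, the form in which the convexity argument
  works.\<close>

lemma nbr_set_eq:
  "{z. nbr x z} = (\<lambda>(i, e). x[i := x ! i + e]) ` ({..<length x} \<times> {1, -1})"
  by (auto intro: nbr_update elim!: nbr_eq_update)

lemma sum_nbr:
  fixes F :: "int list \<Rightarrow> real"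
  shows "(\<Sum>z | nbr x z. F z) = (\<Sum>i<length x. F (x[i := x ! i + 1]) + F (x[i := x ! i - 1]))"
proof -
  have inj: "inj_on (\<lambda>(i, e). x[i := x ! i + e]) ({..<length x} \<times> {1, -1::int})"
  proof (rule inj_onI)
    fix p q :: "nat \<times> int"
    assume *: "p \<in> {..<length x} \<times> {1, -1}" "q \<in> {..<length x} \<times> {1, -1}"
      and eq: "(case p of (i, e) \<Rightarrow> x[i := x ! i + e]) = (case q of (i, e) \<Rightarrow> x[i := x ! i + e])"
    have "fst p = fst q"
      using arg_cong[OF eq, of "\<lambda>l. l ! fst p"] * by (cases "fst p = fst q") (auto split: prod.splits)
    then show "p = q"
      using arg_cong[OF eq, of "\<lambda>l. l ! fst p"] * by (auto split: prod.splits)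
  qed
  show ?thesis unfolding nbr_set_eq
    by (subst sum.reindex[OF inj]) (simp add: sum.cartesian_product' o_def case_prod_unfold)
qed

section \<open>The barrier and its superharmonicity\<close>

definition sqd :: "int list \<Rightarrow> int list \<Rightarrow> int" where
  "sqd x y = (\<Sum>i<length x. (x ! i - y ! i)\<^sup>2)"

definition barrier :: "real \<Rightarrow> int list \<Rightarrow> int list \<Rightarrow> real" where
  "barrier a x y = a * (a + 1) / (real_of_int (sqd x y) + a)"

lemma sqd_nonneg: "sqd x y \<ge> 0"
  by (simp add: sqd_def sum_nonneg)

lemma sqd_self [simp]: "sqd x x = 0"
  by (simp add: sqd_def)

lemma sqd_pos:
  assumes "length x = length y" "x \<noteq> y"
  shows "sqd x y \<ge> 1"
proof -
  obtain i where i: "i < length x" "x ! i \<noteq> y ! i" using assms nth_equalityI by blast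
  have "1 \<le> (x ! i - y ! i)\<^sup>2" using i by (simp add: int_one_le_iff_zero_less)
  also have "\<dots> \<le> sqd x y" unfolding sqd_def using i by (intro member_le_sum) auto
  finally show ?thesis .
qed

lemma sqd_update:
  assumes "i < length x"
  shows "sqd (x[i := x ! i + e]) y = sqd x y + e\<^sup>2 + 2 * e * (x ! i - y ! i)"
proof -
  have *: "sqd z y = (z ! i - y ! i)\<^sup>2 + (\<Sum>k\<in>{..<length x}-{i}. (z ! k - y ! k)\<^sup>2)" if "length z = length x" for z
    unfolding sqd_def using that assms by (subst sum.remove[of _ i]) auto
  have "(\<Sum>k\<in>{..<length x}-{i}. (x[i := x ! i + e] ! k - y ! k)\<^sup>2) = (\<Sum>k\<in>{..<length x}-{i}. (x ! k - y ! k)\<^sup>2)"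
    by (intro sum.cong) auto
  then show ?thesis using *[of x] *[of "x[i := x ! i + e]"] assms
    by (simp add: power2_eq_square algebra_simps)
qed

text \<open>The chord bound for the convex function \<open>s \<mapsto> 1 / (A\<^sup>2 - s)\<close> on \<open>[0, M]\<close> reduces
  superharmonicity to the case of a single nonzero coordinate.\<close>

lemma chord_bound:
  fixes A s M :: real
  assumes "A > 0" "0 \<le> s" "s \<le> M" "M < A\<^sup>2"
  shows "A / (A\<^sup>2 - s) \<le> 1 / A + s / (A * (A\<^sup>2 - M))"
proof -
  have "A / (A\<^sup>2 - s) = 1 / A + s / (A * (A\<^sup>2 - s))"
    using assms by (simp add: field_simps power2_eq_square)
  also have "s / (A * (A\<^sup>2 - s)) \<le> s / (A * (A\<^sup>2 - M))"
    using assms by (intro divide_left_mono mult_left_mono mult_pos_pos) auto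
  finally show ?thesis by simp
qed

text \<open>With \<open>A = N + a + 1\<close> one has
  \<open>1 / (N + a) - 1 / A = 1 / ((N + a) * A)\<close>, so this is exactly what superharmonicity
  away from the source demands once the chord bound is applied with \<open>M = 4 * N\<close>. The
  gap between 1 and 2 is harmless because \<open>N\<close> will be a squared lattice
  distance.\<close>

lemma barrier_coefficient_bound:
  fixes N a d :: real
  assumes d: "d \<ge> 25" and a: "a = 1 / (d - 1)" and N: "N = 1 \<or> N \<ge> 2"
  shows "(N + a) * (4 * N) \<le> d * ((N + a + 1)\<^sup>2 - 4 * N)"
  using N
proof
  assume "N = 1"
  \<comment> \<open>Through this relation the factor \<open>1 + a\<close> comes out of both sides at
    \<open>N = 1\<close>, and only 4 \<le> a + 4 is left.\<close>
  have "a * d = 1 + a" using d a by (simp add: field_simps)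
  moreover have "a > 0" using d a by simp
  ultimately have "d * ((N + a + 1)\<^sup>2 - 4 * N) = (1 + a) * (a + 4)"
    using \<open>N = 1\<close> by (simp add: power2_eq_square algebra_simps)
  moreover have "(1 + a) * 4 \<le> (1 + a) * (a + 4)" using \<open>a > 0\<close> by (intro mult_left_mono) auto
  ultimately show ?thesis using \<open>N = 1\<close> by (simp add: algebra_simps)
next
  assume N: "N \<ge> 2"
  have a01: "0 < a" "a \<le> 1" using d a by auto
  have 1: "(N + a) * (4 * N) \<le> (N + 1) * (4 * N)" using a01 N by (intro mult_right_mono) auto
  \<comment> \<open>For \<open>N \<ge> 2\<close> the terms in \<open>a\<close> are estimated
    crudely; at \<open>N = 2\<close> the remaining inequality
    \<open>(N+1)*(4*N) \<le> d * (N-1)\<^sup>2\<close> reads 24 \<le> d, which is where the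
    threshold on the dimension comes from.\<close>
  have "24 * (N-1)\<^sup>2 - (N+1)*(4*N) = (N - 2) * (20 * N - 12)"
    by (simp add: power2_eq_square algebra_simps)
  moreover have "(N - 2) * (20 * N - 12) \<ge> 0" using N by (intro mult_nonneg_nonneg) auto
  ultimately have 2: "(N+1)*(4*N) \<le> 24 * (N-1)\<^sup>2" by linarith
  have 3: "24 * (N-1)\<^sup>2 \<le> d * (N-1)\<^sup>2" using d by (intro mult_right_mono) auto
  have "(N + a + 1)\<^sup>2 - 4 * N = (N-1)\<^sup>2 + (a * (2 * N + 2) + a\<^sup>2)"
    by (simp add: power2_eq_square algebra_simps)
  moreover have "a * (2 * N + 2) + a\<^sup>2 \<ge> 0" using a01 N by auto
  ultimately have "(N-1)\<^sup>2 \<le> (N + a + 1)\<^sup>2 - 4 * N" by linarith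
  then have "d * (N-1)\<^sup>2 \<le> d * ((N + a + 1)\<^sup>2 - 4 * N)" using d by (intro mult_left_mono) auto
  then show ?thesis using 1 2 3 by linarith
qed

text \<open>The two neighbours in direction \<open>i\<close> have denominators
  \<open>A + 2 * t\<close> and \<open>A - 2 * t\<close> with \<open>t = x ! i - y ! i\<close>, so
  their reciprocals add up to \<open>2 * A / (A\<^sup>2 - s i)\<close>. Since the \<open>s i\<close>
  sum to \<open>4 * N\<close>, the chord bound gives an estimate of the average that depends on
  \<open>x\<close> and \<open>y\<close> only through \<open>N\<close>.\<close>

lemma barrier_superharmonic:
  assumes d: "length x = d" "length y = d" "d \<ge> 25" and a: "a = 1 / (real d - 1)"
  shows "(if x = y then 1 else 0) + (\<Sum>z | nbr x z. barrier a z y) / (2 * real d) \<le> barrier a x y"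
proof -
  define N where "N = real_of_int (sqd x y)"
  define A where "A = N + a + 1"
  define s where "s i = 4 * (real_of_int (x ! i - y ! i))\<^sup>2" for i
  have a0: "a > 0" using d a by simp
  have N0: "N \<ge> 0" using sqd_nonneg[of x y] by (simp add: N_def)
  have A0: "A > 0" using a0 N0 by (simp add: A_def)
  have sum_s: "(\<Sum>i<d. s i) = 4 * N"
    using d by (simp add: s_def N_def sqd_def sum_distrib_left)
  have s_le: "s i \<le> 4 * N" if "i < d" for i
    unfolding sum_s[symmetric] using that by (intro member_le_sum) (auto simp: s_def)
  have "A\<^sup>2 - 4 * N = (N - 1)\<^sup>2 + a * (2 * N + 2) + a\<^sup>2" 
    by (simp add: A_def power2_eq_square algebra_simps)
  moreover have "a * (2 * N + 2) > 0" "(N-1)\<^sup>2 \<ge> 0" "a\<^sup>2 \<ge> 0" using a0 N0 by auto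
  ultimately have M: "4 * N < A\<^sup>2" by linarith
  have pair: "barrier a (x[i := x ! i + 1]) y + barrier a (x[i := x ! i - 1]) y
      = 2 * (a * (a + 1)) * (A / (A\<^sup>2 - s i))" if i: "i < d" for i
  proof -
    define t where "t = real_of_int (x ! i - y ! i)"
    have e1: "real_of_int (sqd (x[i := x ! i + 1]) y) + a = A + 2 * t"
      using sqd_update[of i x 1 y] i d by (simp add: A_def N_def t_def)
    have e2: "real_of_int (sqd (x[i := x ! i - 1]) y) + a = A - 2 * t"
      using sqd_update[of i x "-1" y] i d by (simp add: A_def N_def t_def)
    have p: "A + 2 * t > 0" "A - 2 * t > 0"
      using sqd_nonneg[of "x[i := x ! i + 1]" y] sqd_nonneg[of "x[i := x ! i - 1]" y] a0
      unfolding e1[symmetric] e2[symmetric] by linarith+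
    have "A\<^sup>2 - s i = (A + 2 * t) * (A - 2 * t)"
      by (simp add: s_def t_def power2_eq_square algebra_simps)
    then show ?thesis unfolding barrier_def e1 e2 using p
      by (simp add: field_simps)
  qed
  have scale: "2 * c * (d / A + q / r) / (2 * real d) = c * (1 / A + q / (d * r))" for c q r :: real
    using d by (simp add: add_divide_distrib distrib_left)
  have "(\<Sum>z | nbr x z. barrier a z y) = 2 * (a * (a + 1)) * (\<Sum>i<d. A / (A\<^sup>2 - s i))"
    using d pair by (simp add: sum_nbr sum_distrib_left)
  also have "(\<Sum>i<d. A / (A\<^sup>2 - s i)) \<le> (\<Sum>i<d. 1 / A + s i / (A * (A\<^sup>2 - 4 * N)))"
    using A0 M s_le by (intro sum_mono chord_bound) (auto simp: s_def)
  also have "\<dots> = d / A + 4 * N / (A * (A\<^sup>2 - 4 * N))"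
    by (simp add: sum.distrib sum_divide_distrib[symmetric] sum_s)
  finally have "(\<Sum>z | nbr x z. barrier a z y)
      \<le> 2 * (a * (a + 1)) * (d / A + 4 * N / (A * (A\<^sup>2 - 4 * N)))"
    using a0 by simp
  then have "(\<Sum>z | nbr x z. barrier a z y) / (2 * real d)
      \<le> 2 * (a * (a + 1)) * (d / A + 4 * N / (A * (A\<^sup>2 - 4 * N))) / (2 * real d)"
    by (intro divide_right_mono) auto
  also have "\<dots> = a * (a + 1) * (1 / A + 4 * N / (d * (A * (A\<^sup>2 - 4 * N))))"
    using scale[of "a * (a + 1)" "4 * N" "A * (A\<^sup>2 - 4 * N)"] by simp
  finally have avg: "(\<Sum>z | nbr x z. barrier a z y) / (2 * real d)
      \<le> a * (a + 1) * (1 / A + 4 * N / (d * (A * (A\<^sup>2 - 4 * N))))" .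
  show ?thesis
  proof (cases "x = y")
    case True
    then have "N = 0" by (simp add: N_def)
    \<comment> \<open>At the source all neighbours have distance 1 and equality holds; this fixes
      the normalisation \<open>a * (a + 1)\<close>, the solution C of 1 + C/(a+1) = C/a.\<close>
    have "1 + a * (a+1) * (1 / (a + 1)) = a * (a + 1) / a" using a0 by (simp add: field_simps)
    then show ?thesis using avg True \<open>N = 0\<close> by (simp add: A_def barrier_def)
  next
    case False
    then have "sqd x y \<ge> 1" using d sqd_pos by simp
    then have "sqd x y = 1 \<or> sqd x y \<ge> 2" by linarith
    then have N12: "N = 1 \<or> N \<ge> 2" unfolding N_def by auto
    define D where "D = A\<^sup>2 - 4 * N"
    have D0: "D > 0" using M by (simp add: D_def)
    have "(N + a) * (4 * N) \<le> d * D"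
      using barrier_coefficient_bound[of d a N] d a N12 by (simp add: D_def A_def)
    then have le1: "(N + a) * (4 * N) / (d * D) \<le> 1" using d D0 by simp
    have "p / (d * (A * D)) = q * p / (d * D) * (1 / (q * A))" if "q > 0" for p q :: real
      using that by simp
    from this[of "N + a" "4 * N"]
    have "4 * N / (d * (A * D)) = (N + a) * (4 * N) / (d * D) * (1 / ((N + a) * A))"
      using a0 N0 by simp
    also have "\<dots> \<le> 1 * (1 / ((N + a) * A))"
      using le1 a0 N0 A0 by (intro mult_right_mono) auto
    also have "\<dots> = 1 / ((N + a) * A)" by simp
    also have "\<dots> = 1 / (N + a) - 1 / A" using A0 a0 N0 by (simp add: A_def field_simps)
    finally have "1 / A + 4 * N / (d * (A * D)) \<le> 1 / (N + a)" by linarith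
    then have "a * (a + 1) * (1 / A + 4 * N / (d * (A * D))) \<le> a * (a + 1) * (1 / (N + a))"
      using a0 by (intro mult_left_mono) auto
    then show ?thesis using avg False by (simp add: barrier_def N_def[symmetric] D_def)
  qed
qed

section \<open>Comparison of the Green function with the barrier\<close>

lemma srw_prob_nonneg: "srw_prob n x y \<ge> 0"
  by (induction n arbitrary: x) (auto intro!: sum_nonneg divide_nonneg_nonneg)

text \<open>Conditioning on the first step, the truncated Green function with \<open>Suc N\<close>
  terms is the source term plus the neighbour average of the one with \<open>N\<close> terms.
  Starting from 0, this monotone iteration never rises above a nonnegative supersolution.\<close>

lemma sum_srw_prob_le_barrier:
  assumes "length x = d" "length y = d" "d \<ge> 25" and a: "a = 1 / (real d - 1)"
  shows "(\<Sum>n<N. srw_prob n x y) \<le> barrier a x y"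
  using assms(1)
proof (induction N arbitrary: x)
  case 0
  then show ?case using a assms(3) sqd_nonneg[of x y] by (auto simp: barrier_def)
next
  case (Suc N)
  have "(\<Sum>n<Suc N. srw_prob n x y)
      = (if x = y then 1 else 0) + (\<Sum>z | nbr x z. \<Sum>n<N. srw_prob n z y) / (2 * real d)"
    using Suc.prems
    by (subst sum.lessThan_Suc_shift) (simp add: sum_divide_distrib[symmetric] sum.swap[of _ _ "{..<N}"])
  also have "\<dots> \<le> (if x = y then 1 else 0) + (\<Sum>z | nbr x z. barrier a z y) / (2 * real d)"
    using Suc.prems by (intro add_left_mono divide_right_mono sum_mono Suc.IH) (auto dest: nbr_length)
  also have "\<dots> \<le> barrier a x y"
    using assms Suc.prems by (intro barrier_superharmonic)
  finally show ?case .
qed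

text \<open>The uniform bound on partial sums yields transience first; only then is the
  \<open>suminf\<close> in \<open>green\<close> a genuine sum and inherits the bound.\<close>

lemma
  assumes "length x = d" "length y = d" "d \<ge> 25"
  shows summable_srw_prob: "summable (\<lambda>n. srw_prob n x y)"
    and green_le_barrier: "green x y \<le> barrier (1 / (real d - 1)) x y"
    and green_nonneg: "green x y \<ge> 0"
proof -
  show s: "summable (\<lambda>n. srw_prob n x y)"
    using sum_srw_prob_le_barrier[OF assms refl] by (intro summableI_nonneg_bounded srw_prob_nonneg)
  show "green x y \<le> barrier (1 / (real d - 1)) x y"
    unfolding green_def using sum_srw_prob_le_barrier[OF assms refl] s by (intro suminf_le_const)
  show "green x y \<ge> 0" unfolding green_def using s by (intro suminf_nonneg srw_prob_nonneg)
qed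

lemma green_diag_ge_1:
  assumes "length x = d" "d \<ge> 25"
  shows "green x x \<ge> 1"
  unfolding green_def
  using sum_le_suminf[OF summable_srw_prob[of x d x], of "{0}"] assms srw_prob_nonneg by simp

lemma green_diag_le:
  assumes "length x = d" "d \<ge> 25"
  shows "green x x \<le> 1 + 1 / (real d - 1)"
  using green_le_barrier[of x d x] assms by (simp add: barrier_def)

lemma green_off_diag_le:
  assumes "length x = d" "length y = d" "d \<ge> 25" "x \<noteq> y"
  shows "green x y \<le> 1 / (real d - 1)"
proof -
  define a where "a = 1 / (real d - 1)"
  have a: "a > 0" using assms by (simp add: a_def)
  have N: "real_of_int (sqd x y) \<ge> 1" using sqd_pos[of x y] assms by simp
  have "green x y \<le> barrier a x y" using green_le_barrier[OF assms(1-3)] by (simp add: a_def)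
  also have "\<dots> \<le> a * (a + 1) / (1 + a)" unfolding barrier_def
    using a N by (intro divide_left_mono mult_pos_pos) auto
  also have "\<dots> = a" using a by (simp add: field_simps)
  finally show ?thesis by (simp add: a_def)
qed

section \<open>Symmetries of the Green function\<close>

text \<open>A graph automorphism that is its own inverse permutes the neighbours, so it reindexes
  the one-step sum with \<open>T\<close> as the witness in both directions.\<close>

lemma srw_prob_involution:
  assumes T: "\<And>x. length x = d \<Longrightarrow> length (T x) = d" "\<And>x. length x = d \<Longrightarrow> T (T x) = x"
    "\<And>x y. length x = d \<Longrightarrow> nbr x y \<Longrightarrow> nbr (T x) (T y)"
    and "length x = d" "length y = d"
  shows "srw_prob n (T x) (T y) = srw_prob n x y"
  using assms(4)
proof (induction n arbitrary: x)
  case 0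
  then have "T x = T y \<longleftrightarrow> x = y" using T(2) \<open>length y = d\<close> by metis
  then show ?case by simp
next
  case (Suc n)
  have "(\<Sum>z | nbr (T x) z. srw_prob n z (T y)) = (\<Sum>z | nbr x z. srw_prob n (T z) (T y))"
  proof (rule sum.reindex_bij_witness[of _ T T])
    fix z assume "z \<in> {z. nbr (T x) z}"
    then show "T (T z) = z" "T z \<in> {z. nbr x z}" "srw_prob n (T (T z)) (T y) = srw_prob n z (T y)"
      using T Suc.prems nbr_length by (metis mem_Collect_eq)+
  next
    fix z assume "z \<in> {z. nbr x z}"
    then show "T (T z) = z" "T z \<in> {z. nbr (T x) z}"
      using T Suc.prems nbr_length by (metis mem_Collect_eq)+
  qed
  also have "\<dots> = (\<Sum>z | nbr x z. srw_prob n z y)"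
    using Suc by (intro sum.cong) (auto dest: nbr_length)
  finally show ?case using T(1) Suc.prems by simp
qed

section \<open>Cube symmetries that fix a corner\<close>

lemma hypercube_length: "v \<in> hypercube d \<Longrightarrow> length v = d"
  by (simp add: hypercube_def)

lemma hypercube_nth: "v \<in> hypercube d \<Longrightarrow> i < d \<Longrightarrow> v ! i = 0 \<or> v ! i = 1"
  using nth_mem[of i v] unfolding hypercube_def by blast

definition flip :: "int list \<Rightarrow> nat \<Rightarrow> int list" where
  "flip v i = v[i := 1 - v ! i]"

text \<open>Exchanges the coordinates \<open>i\<close> and \<open>k\<close>, read off relative to the corner \<open>v\<close> of the cube.\<close>

definition swap_at :: "int list \<Rightarrow> nat \<Rightarrow> nat \<Rightarrow> int list \<Rightarrow> int list" where
  "swap_at v i k x = map (\<lambda>l. if l \<in> {i, k} \<and> v ! i \<noteq> v ! k then 1 - x ! (Transposition.transpose i k l)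
      else x ! (Transposition.transpose i k l)) [0..<length x]"

lemma length_flip [simp]: "length (flip v i) = length v"
  by (simp add: flip_def)

lemma length_swap_at [simp]: "length (swap_at v i k x) = length x"
  by (simp add: swap_at_def)

lemma transpose_less:
  fixes i :: nat
  shows "i < d \<Longrightarrow> k < d \<Longrightarrow> l < d \<Longrightarrow> Transposition.transpose i k l < d"
  by (auto simp: Transposition.transpose_def)

lemma nth_swap_at:
  assumes "l < length x"
  shows "swap_at v i k x ! l = (if l \<in> {i, k} \<and> v ! i \<noteq> v ! k
    then 1 - x ! Transposition.transpose i k l else x ! Transposition.transpose i k l)"
  using assms by (simp add: swap_at_def)

lemma swap_at_swap_at:
  assumes "length x = d" "i < d" "k < d"
  shows "swap_at v i k (swap_at v i k x) = x"
proof (rule nth_equalityI)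
  fix l assume l: "l < length (swap_at v i k (swap_at v i k x))"
  then have "l < d" "Transposition.transpose i k l < d" using assms transpose_less by auto
  moreover have "Transposition.transpose i k l \<in> {i, k} \<longleftrightarrow> l \<in> {i, k}"
    by (auto simp: Transposition.transpose_def)
  ultimately show "swap_at v i k (swap_at v i k x) ! l = x ! l"
    using assms by (simp add: nth_swap_at)
qed simp

lemma nbr_swap_at:
  assumes "length x = d" "i < d" "k < d" "nbr x y"
  shows "nbr (swap_at v i k x) (swap_at v i k y)"
proof -
  have len: "length y = d" using assms nbr_length by metis
  have "(\<Sum>l<d. \<bar>swap_at v i k y ! l - swap_at v i k x ! l\<bar>)
      = (\<Sum>l<d. \<bar>y ! Transposition.transpose i k l - x ! Transposition.transpose i k l\<bar>)"
    using assms len by (intro sum.cong) (auto simp: swap_at_def)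
  also have "\<dots> = (\<Sum>l<d. \<bar>y ! l - x ! l\<bar>)"
    using assms by (intro sum.reindex_bij_witness[of _ "Transposition.transpose i k" "Transposition.transpose i k"])
      (auto simp: transpose_less)
  finally show ?thesis using assms len by (simp add: nbr_def)
qed

lemma green_swap_at:
  assumes "length x = d" "length y = d" "i < d" "k < d"
  shows "green (swap_at v i k x) (swap_at v i k y) = green x y"
proof -
  have "srw_prob n (swap_at v i k x) (swap_at v i k y) = srw_prob n x y" for n
    using assms by (intro srw_prob_involution[where d = d]) (auto simp: swap_at_swap_at nbr_swap_at)
  then show ?thesis by (simp add: green_def)
qed

text \<open>The map fixes the corner \<open>v\<close>: when the two coordinates differ, the
  reflection undoes the effect of exchanging them. Hence it can only permute the cube neighbours of
  \<open>v\<close>, and it does so by the transposition of \<open>i\<close> and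
  \<open>k\<close>.\<close>

lemma swap_at_flip:
  assumes "v \<in> hypercube d" "i < d" "k < d" "j < d"
  shows "swap_at v i k (flip v j) = flip v (Transposition.transpose i k j)"
proof -
  note v = hypercube_nth[OF assms(1)]
  have len: "length v = d" using assms by (simp add: hypercube_def)
  show ?thesis
  proof (rule nth_equalityI)
    fix l assume "l < length (swap_at v i k (flip v j))"
    then have l: "l < d" using len by simp
    have t: "Transposition.transpose i k l < d" using assms l transpose_less by auto
    have eq: "Transposition.transpose i k l = j \<longleftrightarrow> Transposition.transpose i k j = l"
      by (metis transpose_involutory)
    show "swap_at v i k (flip v j) ! l = flip v (Transposition.transpose i k j) ! l"
    proof (cases "Transposition.transpose i k l = j")
      case True
      then have "Transposition.transpose i k j = l" using eq by simp
      then show ?thesis using True l t len v[of i] v[of k] assms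
        by (cases "l = i"; cases "l = k") (auto simp: nth_swap_at flip_def)
    next
      case False
      then have "Transposition.transpose i k j \<noteq> l" using eq by simp
      then show ?thesis using False l t len v[of i] v[of k] assms
        by (cases "l = i"; cases "l = k") (auto simp: nth_swap_at flip_def)
    qed
  qed simp
qed

lemma green_flip_diag:
  assumes "v \<in> hypercube d" "i < d" "k < d"
  shows "green (flip v i) (flip v i) = green (flip v k) (flip v k)"
  using green_swap_at[of "flip v i" d "flip v i" i k v] swap_at_flip[of v d i k i] assms
  by (simp add: hypercube_def)

text \<open>Two transpositions carry any ordered pair of distinct indices to any other: the first
  moves \<open>i\<close> to \<open>k\<close> and \<open>j\<close> to some \<open>j'\<close>, the
  second moves \<open>j'\<close> to \<open>l\<close> and leaves \<open>k\<close> in place.\<close>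

lemma green_flip_off_diag:
  assumes "v \<in> hypercube d" "i < d" "j < d" "k < d" "l < d" "i \<noteq> j" "k \<noteq> l"
  shows "green (flip v i) (flip v j) = green (flip v k) (flip v l)"
proof -
  have *: "green (flip v (Transposition.transpose p q i)) (flip v (Transposition.transpose p q j)) = green (flip v i) (flip v j)"
    if "p < d" "q < d" "i < d" "j < d" for p q i j
    using green_swap_at[of "flip v i" d "flip v j" p q v] swap_at_flip[of v d p q] assms(1) that
    by (simp add: hypercube_def)
  define j' where "j' = Transposition.transpose i k j"
  have j': "j' < d" "j' \<noteq> k" using assms transpose_less[of i d k j]
    by (auto simp: j'_def Transposition.transpose_def split: if_splits)
  have "green (flip v i) (flip v j) = green (flip v k) (flip v j')"
    using *[of i k i j] assms by (simp add: j'_def)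
  also have "\<dots> = green (flip v k) (flip v l)"
    using *[of j' l k j'] assms j' by (simp add: Transposition.transpose_def)
  finally show ?thesis .
qed

section \<open>Gaussian vectors from characteristic functions\<close>

text \<open>Dividing the weight by its mean gives a probability density, under which
  \<open>X\<close> has characteristic function \<open>char \<mu>\<close>; Levy's theorem then
  identifies its law. If the mean vanishes, so does \<open>W\<close> almost everywhere and both
  sides are 0.\<close>

lemma (in prob_space) weighted_Levy_uniqueness:
  fixes X W :: "'a \<Rightarrow> real"
  assumes X [measurable]: "X \<in> borel_measurable M" and W [measurable]: "W \<in> borel_measurable M"
    and W0: "\<And>\<omega>. W \<omega> \<ge> 0" and Wle: "\<And>\<omega>. W \<omega> \<le> K"
    and \<mu>: "real_distribution \<mu>"
    and char: "\<And>s. (LINT \<omega>|M. W \<omega> *\<^sub>R iexp (s * X \<omega>)) = of_real c * char \<mu> s"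
    and A [measurable]: "A \<in> sets borel"
  shows "(LINT \<omega>|M. W \<omega> * indicator A (X \<omega>)) = c * measure \<mu> A"
proof -
  interpret \<mu>: real_distribution \<mu> by fact
  have intW: "integrable M W"
    using W0 Wle by (intro integrable_const_bound[of _ K]) auto
  \<comment> \<open>Evaluating the hypothesis at frequency 0 shows that \<open>c\<close> is the mean
    of the weight.\<close>
  have "complex_of_real c = (LINT \<omega>|M. of_real (W \<omega>))"
    using char[of 0] \<mu>.char_zero by (simp add: scaleR_conv_of_real)
  also have "\<dots> = of_real (LINT \<omega>|M. W \<omega>)" by (rule integral_complex_of_real)
  finally have c: "c = (LINT \<omega>|M. W \<omega>)" by (simp only: of_real_eq_iff)
  have c0: "c \<ge> 0" unfolding c using W0 by (intro integral_nonneg_AE) auto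
  show ?thesis
  proof (cases "c = 0")
    case True
    then have "AE \<omega> in M. W \<omega> = 0"
      using c integral_nonneg_eq_0_iff_AE[OF intW] W0 by auto
    then have "(LINT \<omega>|M. W \<omega> * indicator A (X \<omega>)) = (LINT \<omega>|M. 0)"
      by (intro integral_cong_AE) auto
    then show ?thesis using True by simp
  next
    case False
    then have cpos: "c > 0" using c0 by simp
    define M' where "M' = density M (\<lambda>\<omega>. ennreal (W \<omega> / c))"
    have m' [measurable_cong, simp]: "sets M' = sets M" by (simp add: M'_def)
    have "emeasure M' (space M') = (\<integral>\<^sup>+\<omega>. ennreal (W \<omega> / c) \<partial>M)"
      unfolding M'_def by (simp add: emeasure_density cong: nn_integral_cong)
    also have "\<dots> = ennreal (LINT \<omega>|M. W \<omega> / c)"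
      using intW W0 cpos by (intro nn_integral_eq_integral) auto
    also have "(LINT \<omega>|M. W \<omega> / c) = 1" using c False by simp
    finally interpret M': prob_space M' by (intro prob_spaceI) simp
    have [measurable]: "X \<in> borel_measurable M'" by measurable
    interpret D: real_distribution "distr M' borel X"
      by (intro M'.real_distribution_distr) simp
    have "char (distr M' borel X) s = char \<mu> s" for s
    proof -
      have "char (distr M' borel X) s = (LINT \<omega>|M'. iexp (s * X \<omega>))"
        unfolding char_def by (subst integral_distr) auto
      also have "\<dots> = (LINT \<omega>|M. (W \<omega> / c) *\<^sub>R iexp (s * X \<omega>))"
        unfolding M'_def using W0 cpos by (subst integral_density) auto
      also have "\<dots> = (LINT \<omega>|M. (1 / c) *\<^sub>R (W \<omega> *\<^sub>R iexp (s * X \<omega>)))"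
        by (intro Bochner_Integration.integral_cong) auto
      also have "\<dots> = (1 / c) *\<^sub>R (LINT \<omega>|M. W \<omega> *\<^sub>R iexp (s * X \<omega>))"
        by (rule integral_scaleR_right)
      also have "\<dots> = char \<mu> s" using char[of s] False by (simp add: scaleR_conv_of_real)
      finally show ?thesis .
    qed
    then have eq: "distr M' borel X = \<mu>"
      by (intro Levy_uniqueness D.real_distribution_axioms \<mu> ext)
    have "measure \<mu> A = (LINT x|\<mu>. indicator A x)" by simp
    also have "\<dots> = (LINT \<omega>|M'. indicator A (X \<omega>))"
      unfolding eq[symmetric] by (subst integral_distr) auto
    also have "\<dots> = (LINT \<omega>|M. (W \<omega> / c) *\<^sub>R indicator A (X \<omega>))"
      unfolding M'_def using W0 cpos by (subst integral_density) auto
    also have "\<dots> = (LINT \<omega>|M. W \<omega> * indicator A (X \<omega>)) / c" by simp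
    finally show ?thesis using False by simp
  qed
qed

text \<open>Weights of the form \<open>1 + cos\<close> and \<open>1 + sin\<close> are nonnegative, so Levy's theorem for
  probability measures applies to them; their differences with the weight \<open>1\<close> recover \<open>iexp T\<close>.\<close>

lemma (in prob_space) indicator_iexp_factor:
  fixes X T :: "'a \<Rightarrow> real"
  assumes X [measurable]: "X \<in> borel_measurable M" and T [measurable]: "T \<in> borel_measurable M"
    and B [measurable]: "B \<in> sets M" and A [measurable]: "A \<in> sets borel"
    and \<mu>: "real_distribution \<mu>"
    and factor: "\<And>s t. (LINT \<omega>|M. indicator B \<omega> *\<^sub>R iexp (s * X \<omega> + t * T \<omega>))
        = char \<mu> s * (LINT \<omega>|M. indicator B \<omega> *\<^sub>R iexp (t * T \<omega>))"
  shows "(LINT \<omega>|M. (indicator B \<omega> * indicator A (X \<omega>)) *\<^sub>R iexp (T \<omega>))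
        = of_real (measure \<mu> A) * (LINT \<omega>|M. indicator B \<omega> *\<^sub>R iexp (T \<omega>))"
proof -
  interpret \<mu>: real_distribution \<mu> by fact
  have int: "integrable M (\<lambda>\<omega>. w \<omega> *\<^sub>R iexp (f \<omega>))"
    if [measurable]: "f \<in> borel_measurable M" "w \<in> borel_measurable M" and "\<And>\<omega>. \<bar>w \<omega>\<bar> \<le> 1" for f w :: "'a \<Rightarrow> real"
    using that by (intro integrable_const_bound[of _ 1]) auto
  have intr: "integrable M (\<lambda>\<omega>. w \<omega> * f \<omega>)"
    if [measurable]: "f \<in> borel_measurable M" "w \<in> borel_measurable M"
      and "\<And>\<omega>. \<bar>w \<omega>\<bar> \<le> 1" "\<And>\<omega>. \<bar>f \<omega>\<bar> \<le> 1" for f w :: "'a \<Rightarrow> real"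
    using that by (intro integrable_const_bound[of _ 1]) (auto simp: abs_mult intro!: mult_le_one)
  define e where "e t = (LINT \<omega>|M. indicator B \<omega> *\<^sub>R iexp (t * T \<omega>))" for t
  have shifted: "(LINT \<omega>|M. indicator B \<omega> * (1 + cos (T \<omega> + \<theta>)) * indicator A (X \<omega>))
      = (LINT \<omega>|M. indicator B \<omega> * (1 + cos (T \<omega> + \<theta>))) * measure \<mu> A" for \<theta>
  proof -
    define W where "W \<omega> = indicator B \<omega> * (1 + cos (T \<omega> + \<theta>))" for \<omega>
    define E where "E = e 0 + iexp \<theta> / 2 * e 1 + iexp (-\<theta>) / 2 * e (-1)"
    have Wm [measurable]: "W \<in> borel_measurable M" unfolding W_def by measurable
    have ch: "(LINT \<omega>|M. W \<omega> *\<^sub>R iexp (s * X \<omega>)) = char \<mu> s * E" for s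
    proof -
      have cosE: "complex_of_real (cos u) = (iexp u + iexp (-u)) / 2" for u
        by (simp add: cos_exp_eq cos_of_real[symmetric])
      \<comment> \<open>Splitting the cosine into two exponentials produces three integrals to which
        \<open>factor\<close> applies, with \<open>t\<close> equal to 0, 1 and -1.\<close>
      have "W \<omega> *\<^sub>R iexp (s * X \<omega>) = indicator B \<omega> *\<^sub>R iexp (s * X \<omega> + 0 * T \<omega>)
        + iexp \<theta> / 2 * (indicator B \<omega> *\<^sub>R iexp (s * X \<omega> + 1 * T \<omega>))
        + iexp (-\<theta>) / 2 * (indicator B \<omega> *\<^sub>R iexp (s * X \<omega> + (-1) * T \<omega>))" for \<omega>
      proof -
        have ring: "J * (1 + (p * q + p' * q') / 2) * x = J * x + q / 2 * (J * (x * p)) + q' / 2 * (J * (x * p'))"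
          for J p q p' q' x :: complex by (simp add: field_simps)
        have e: "iexp (u + v) = iexp u * iexp v" for u v by (simp add: exp_add distrib_left)
        have cs: "complex_of_real (cos (T \<omega> + \<theta>))
            = (iexp (T \<omega>) * iexp \<theta> + iexp (-1 * T \<omega>) * iexp (-\<theta>)) / 2"
          unfolding cosE e[symmetric] by (simp add: algebra_simps)
        have "W \<omega> *\<^sub>R iexp (s * X \<omega>)
            = of_real (indicator B \<omega>) * (1 + complex_of_real (cos (T \<omega> + \<theta>))) * iexp (s * X \<omega>)"
          by (simp only: W_def scaleR_conv_of_real of_real_mult of_real_add of_real_1)
        also have "\<dots> = of_real (indicator B \<omega>) * iexp (s * X \<omega>)
            + iexp \<theta> / 2 * (of_real (indicator B \<omega>) * (iexp (s * X \<omega>) * iexp (T \<omega>)))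
            + iexp (-\<theta>) / 2 * (of_real (indicator B \<omega>) * (iexp (s * X \<omega>) * iexp (-1 * T \<omega>)))"
          unfolding cs by (rule ring)
        finally show ?thesis
          by (simp only: scaleR_conv_of_real e mult_1 mult_zero_left add_0_right)
      qed
      then have "(LINT \<omega>|M. W \<omega> *\<^sub>R iexp (s * X \<omega>)) = (LINT \<omega>|M. indicator B \<omega> *\<^sub>R iexp (s * X \<omega> + 0 * T \<omega>))
        + iexp \<theta> / 2 * (LINT \<omega>|M. indicator B \<omega> *\<^sub>R iexp (s * X \<omega> + 1 * T \<omega>))
        + iexp (-\<theta>) / 2 * (LINT \<omega>|M. indicator B \<omega> *\<^sub>R iexp (s * X \<omega> + (-1) * T \<omega>))"
        by (simp only: ) (subst Bochner_Integration.integral_add Bochner_Integration.integral_mult_right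
            | intro Bochner_Integration.integrable_add integrable_mult_right int | simp add: indicator_def)+
      then show ?thesis unfolding factor E_def e_def by (simp only: distrib_left mult_ac)
    qed
    have "(LINT \<omega>|M. W \<omega> *\<^sub>R iexp (0 * X \<omega>)) = of_real (LINT \<omega>|M. W \<omega>)"
      by (simp add: scaleR_conv_of_real)
    then have "E = of_real (LINT \<omega>|M. W \<omega>)" using ch[of 0] \<mu>.char_zero by simp
    then have ch': "(LINT \<omega>|M. W \<omega> *\<^sub>R iexp (s * X \<omega>)) = of_real (LINT \<omega>|M. W \<omega>) * char \<mu> s" for s
      unfolding ch[of s] by (simp add: mult.commute)
    have "1 + cos u \<ge> 0" for u :: real using cos_ge_minus_one[of u] by linarith
    then have W0: "W \<omega> \<ge> 0" for \<omega> by (auto simp: W_def indicator_def)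
    have W2: "W \<omega> \<le> 2" for \<omega> using cos_le_one[of "T \<omega> + \<theta>"] by (auto simp: W_def indicator_def)
    from weighted_Levy_uniqueness[OF X Wm W0 W2 \<mu> ch' A] show ?thesis by (simp add: W_def)
  qed
  have "(LINT \<omega>|M. indicator B \<omega> *\<^sub>R iexp (s * X \<omega>)) = of_real (measure M B) * char \<mu> s" for s
    using factor[of s 0] by (simp add: scaleR_conv_of_real mult.commute)
  then have plain: "(LINT \<omega>|M. indicator B \<omega> * indicator A (X \<omega>)) = measure M B * measure \<mu> A"
    using \<mu> by (intro weighted_Levy_uniqueness[of _ _ 1]) (auto simp: indicator_def)
  \<comment> \<open>Subtracting the identity for weight \<open>indicator B\<close> from the one for
    the shifted weight isolates the cosine.\<close>
  have trig: "(LINT \<omega>|M. indicator B \<omega> * indicator A (X \<omega>) * cos (T \<omega> + \<theta>))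
      = measure \<mu> A * (LINT \<omega>|M. indicator B \<omega> * cos (T \<omega> + \<theta>))" for \<theta>
  proof -
    have i1: "integrable M (\<lambda>\<omega>. indicator B \<omega> * indicator A (X \<omega>) * cos (T \<omega> + \<theta>))"
      and i2: "integrable M (\<lambda>\<omega>. indicator B \<omega> * cos (T \<omega> + \<theta>))"
      and i3: "integrable M (\<lambda>\<omega>. indicator B \<omega> * indicator A (X \<omega>) :: real)"
      by (intro intr; simp add: indicator_def)+
    have "(LINT \<omega>|M. indicator B \<omega> * (1 + cos (T \<omega> + \<theta>)) * indicator A (X \<omega>))
      = (LINT \<omega>|M. indicator B \<omega> * indicator A (X \<omega>) + indicator B \<omega> * indicator A (X \<omega>) * cos (T \<omega> + \<theta>))"
      by (intro Bochner_Integration.integral_cong) (auto simp: algebra_simps)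
    also have "\<dots> = measure M B * measure \<mu> A + (LINT \<omega>|M. indicator B \<omega> * indicator A (X \<omega>) * cos (T \<omega> + \<theta>))"
      using i1 i3 plain by simp
    finally have 1: "(LINT \<omega>|M. indicator B \<omega> * (1 + cos (T \<omega> + \<theta>)) * indicator A (X \<omega>)) = \<dots>" .
    have "(LINT \<omega>|M. indicator B \<omega> * (1 + cos (T \<omega> + \<theta>))) = (LINT \<omega>|M. indicator B \<omega> + indicator B \<omega> * cos (T \<omega> + \<theta>))"
      by (intro Bochner_Integration.integral_cong) (auto simp: algebra_simps)
    also have "\<dots> = measure M B + (LINT \<omega>|M. indicator B \<omega> * cos (T \<omega> + \<theta>))"
      using i2 integrable_const_bound[of "indicat_real B" 1]
      by (subst Bochner_Integration.integral_add) auto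
    finally show ?thesis using 1 shifted[of \<theta>] by (simp add: algebra_simps)
  qed
  \<comment> \<open>The shifts 0 and -pi/2 give the cosine and the sine, that is, the real and
    imaginary parts of \<open>iexp (T \<omega>)\<close>.\<close>
  have split: "(LINT \<omega>|M. w \<omega> *\<^sub>R iexp (T \<omega>)) = of_real (LINT \<omega>|M. w \<omega> * cos (T \<omega> + 0))
      + \<i> * of_real (LINT \<omega>|M. w \<omega> * cos (T \<omega> + (-pi/2)))"
    if [measurable]: "w \<in> borel_measurable M" and w: "\<And>\<omega>. \<bar>w \<omega>\<bar> \<le> 1" for w
  proof -
    have "w \<omega> *\<^sub>R iexp (T \<omega>) = of_real (w \<omega> * cos (T \<omega>)) + \<i> * of_real (w \<omega> * sin (T \<omega>))" for \<omega>
      unfolding cis_conv_exp[symmetric] by (simp add: complex_eq_iff)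
    then have "(LINT \<omega>|M. w \<omega> *\<^sub>R iexp (T \<omega>))
        = (LINT \<omega>|M. of_real (w \<omega> * cos (T \<omega>)) + \<i> * of_real (w \<omega> * sin (T \<omega>)))" by simp
    also have "\<dots> = (LINT \<omega>|M. of_real (w \<omega> * cos (T \<omega>))) + (LINT \<omega>|M. \<i> * of_real (w \<omega> * sin (T \<omega>)))"
      using w by (intro Bochner_Integration.integral_add integrable_mult_right integrable_of_real intr) auto
    also have "\<dots> = of_real (LINT \<omega>|M. w \<omega> * cos (T \<omega>)) + \<i> * of_real (LINT \<omega>|M. w \<omega> * sin (T \<omega>))"
      by (simp only: integral_complex_of_real integral_mult_right_zero)
    finally show ?thesis by (simp add: cos_diff)
  qed
  have s1: "(LINT \<omega>|M. (indicator B \<omega> * indicator A (X \<omega>)) *\<^sub>R iexp (T \<omega>))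
    = of_real (LINT \<omega>|M. indicator B \<omega> * indicator A (X \<omega>) * cos (T \<omega> + 0))
      + \<i> * of_real (LINT \<omega>|M. indicator B \<omega> * indicator A (X \<omega>) * cos (T \<omega> + (-pi/2)))"
    by (rule split) (auto simp: indicator_def)
  have s2: "(LINT \<omega>|M. indicator B \<omega> *\<^sub>R iexp (T \<omega>))
    = of_real (LINT \<omega>|M. indicator B \<omega> * cos (T \<omega> + 0))
      + \<i> * of_real (LINT \<omega>|M. indicator B \<omega> * cos (T \<omega> + (-pi/2)))"
    by (rule split) (auto simp: indicator_def)
  show ?thesis unfolding s1 s2 trig by (simp add: algebra_simps)
qed

text \<open>Independence is extracted one coordinate at a time, using uniqueness only on the real
  line: each step trades a factor \<open>char \<mu>\<close> for the event that the next coordinate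
  lies in \<open>A\<close>.\<close>

lemma (in prob_space) prob_all_in_if_char_product:
  fixes Z :: "nat \<Rightarrow> 'a \<Rightarrow> real"
  assumes Z: "\<And>k. k < n \<Longrightarrow> Z k \<in> borel_measurable M"
    and \<mu>: "real_distribution \<mu>" and A [measurable]: "A \<in> sets borel"
    and char: "\<And>a. (LINT \<omega>|M. iexp (\<Sum>k<n. a k * Z k \<omega>)) = (\<Prod>k<n. char \<mu> (a k))"
  shows "prob {\<omega> \<in> space M. \<forall>k<n. Z k \<omega> \<in> A} = measure \<mu> A ^ n"
proof -
  interpret \<mu>: real_distribution \<mu> by fact
  define B where "B m = {\<omega> \<in> space M. \<forall>k<m. Z k \<omega> \<in> A}" for m
  have B: "B m \<in> sets M" if "m \<le> n" for m
  proof -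
    have "B m = {\<omega> \<in> space M. \<forall>k\<in>{..<m}. Z k \<omega> \<in> A}" by (auto simp: B_def)
    also have "\<dots> \<in> sets M"
      using that Z by (intro sets.sets_Collect_finite_All) (auto intro!: measurable_sets_Collect)
    finally show ?thesis .
  qed
  \<comment> \<open>This interpolates between the hypothesis at \<open>m = 0\<close> and the claim
    at \<open>m = n\<close>, where the exponential is 1. The coefficients must stay arbitrary in the
    induction.\<close>
  have "(LINT \<omega>|M. indicator (B m) \<omega> *\<^sub>R iexp (\<Sum>k\<in>{m..<n}. a k * Z k \<omega>))
      = of_real (measure \<mu> A ^ m) * (\<Prod>k\<in>{m..<n}. char \<mu> (a k))" if "m \<le> n" for m a
    using that
  proof (induction m arbitrary: a)
    case 0
    have "(LINT \<omega>|M. indicator (B 0) \<omega> *\<^sub>R iexp (\<Sum>k\<in>{0..<n}. a k * Z k \<omega>))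
        = (LINT \<omega>|M. iexp (\<Sum>k<n. a k * Z k \<omega>))"
      by (intro Bochner_Integration.integral_cong) (auto simp: B_def atLeast0LessThan)
    then show ?case using char[of a] by (simp add: atLeast0LessThan)
  next
    case (Suc m)
    then have m: "m < n" by simp
    note [measurable] = Z[OF m] B[of m, OF less_imp_le[OF m]]
    define T where "T \<omega> = (\<Sum>k\<in>{Suc m..<n}. a k * Z k \<omega>)" for \<omega>
    have T [measurable]: "T \<in> borel_measurable M" unfolding T_def
      using Z by (intro borel_measurable_sum borel_measurable_times) auto
    have *: "(LINT \<omega>|M. indicator (B m) \<omega> *\<^sub>R iexp (s * Z m \<omega> + t * T \<omega>))
       = of_real (measure \<mu> A ^ m) * (char \<mu> s * (\<Prod>k\<in>{Suc m..<n}. char \<mu> (t * a k)))" for s t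
    proof -
      \<comment> \<open>Giving coordinate \<open>m\<close> its own frequency and scaling the later
        ones by \<open>t\<close> turns the induction hypothesis into the two-parameter factorisation
        that \<open>indicator_iexp_factor\<close> asks for.\<close>
      define a' where "a' k = (if k = m then s else t * a k)" for k
      have "(\<Sum>k\<in>{m..<n}. a' k * Z k \<omega>) = s * Z m \<omega> + t * T \<omega>" for \<omega>
        using m by (simp add: sum.atLeast_Suc_lessThan a'_def T_def sum_distrib_left mult.assoc)
      moreover have "(\<Prod>k\<in>{m..<n}. char \<mu> (a' k)) = char \<mu> s * (\<Prod>k\<in>{Suc m..<n}. char \<mu> (t * a k))"
        using m by (simp add: prod.atLeast_Suc_lessThan a'_def)
      ultimately show ?thesis using Suc.IH[of a'] m by simp
    qed
    have t: "(LINT \<omega>|M. indicator (B m) \<omega> *\<^sub>R iexp (t * T \<omega>))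
       = of_real (measure \<mu> A ^ m) * (\<Prod>k\<in>{Suc m..<n}. char \<mu> (t * a k))" for t
      using *[of 0 t] \<mu>.char_zero by simp
    have "(LINT \<omega>|M. indicator (B (Suc m)) \<omega> *\<^sub>R iexp (T \<omega>))
        = (LINT \<omega>|M. (indicator (B m) \<omega> * indicator A (Z m \<omega>)) *\<^sub>R iexp (T \<omega>))"
      by (intro Bochner_Integration.integral_cong) (auto simp: B_def indicator_def less_Suc_eq)
    also have "\<dots> = of_real (measure \<mu> A) * (LINT \<omega>|M. indicator (B m) \<omega> *\<^sub>R iexp (T \<omega>))"
    proof (rule indicator_iexp_factor[OF _ T _ A \<mu>])
      show "(LINT \<omega>|M. indicator (B m) \<omega> *\<^sub>R iexp (s * Z m \<omega> + t * T \<omega>))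
          = char \<mu> s * (LINT \<omega>|M. indicator (B m) \<omega> *\<^sub>R iexp (t * T \<omega>))" for s t
        unfolding * t by (rule mult.left_commute)
    qed measurable
    also have "\<dots> = of_real (measure \<mu> A ^ Suc m) * (\<Prod>k\<in>{Suc m..<n}. char \<mu> (a k))"
      using t[of 1] by simp
    finally show ?case by (simp add: T_def)
  qed
  from this[of n] have "complex_of_real (measure M (B n)) = of_real (measure \<mu> A ^ n)"
    using B[of n] by (simp add: scaleR_conv_of_real)
  then show ?thesis unfolding of_real_eq_iff by (simp add: B_def)
qed

text \<open>The parameter is the variance. As an image of the standard normal law it includes the
  point mass at \<open>v = 0\<close>, which occurs below when the covariance \<open>\<rho>\<close>
  is 0 and nothing is subtracted.\<close>

definition normal_law :: "real \<Rightarrow> real measure" where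
  "normal_law v = distr std_normal_distribution borel (\<lambda>x. sqrt v * x)"

lemma real_distribution_normal_law: "real_distribution (normal_law v)"
proof -
  interpret N: real_distribution std_normal_distribution by (rule real_dist_normal_dist)
  show ?thesis unfolding normal_law_def by (intro N.real_distribution_distr) simp
qed

lemma char_normal_law:
  assumes "v \<ge> 0"
  shows "char (normal_law v) s = of_real (exp (- (v * s\<^sup>2) / 2))"
proof -
  have "char (normal_law v) s = char std_normal_distribution (s * sqrt v)"
    unfolding char_def normal_law_def by (subst integral_distr) (auto simp: mult_ac)
  then show ?thesis using assms by (simp add: char_std_normal_distribution power_mult_distrib mult.commute)
qed

section \<open>Tails of centred normal laws\<close>

lemma measure_std_normal:
  assumes [measurable]: "A \<in> sets borel"
  shows "measure std_normal_distribution A = (LINT x|lborel. std_normal_density x * indicator A x)"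
proof -
  interpret N: real_distribution std_normal_distribution by (rule real_dist_normal_dist)
  have "measure std_normal_distribution A = (LINT x|std_normal_distribution. indicator A x)"
    by simp
  also have "\<dots> = (LINT x|lborel. std_normal_density x *\<^sub>R indicator A x)"
    by (subst integral_density) auto
  finally show ?thesis by simp
qed

text \<open>For x < -u one has \<open>x\<^sup>2 \<ge> u\<^sup>2 + (x + u)\<^sup>2\<close>, so the
  density is dominated by \<open>exp (- u\<^sup>2 / 2)\<close> times the normal density centred at
  -u, whose total mass is 1.\<close>

lemma std_normal_lower_tail_le:
  assumes "u \<ge> 0"
  shows "measure std_normal_distribution {..< -u} \<le> exp (- u\<^sup>2 / 2)"
proof -
  have "(LINT x|lborel. std_normal_density x * indicator {..< -u} x)
      \<le> (LINT x|lborel. exp (- u\<^sup>2 / 2) * normal_density (-u) 1 x)"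
  proof (rule integral_mono)
    show "integrable lborel (\<lambda>x. std_normal_density x * indicat_real {..< - u} x)"
      by (intro integrable_real_mult_indicator) auto
    show "integrable lborel (\<lambda>x. exp (- u\<^sup>2 / 2) * normal_density (-u) 1 x)" by simp
    fix x :: real
    show "std_normal_density x * indicat_real {..< - u} x \<le> exp (- u\<^sup>2 / 2) * normal_density (-u) 1 x"
    proof (cases "x < -u")
      case True
      then have "(- u - x) * u \<ge> 0" using assms by (intro mult_nonneg_nonneg) auto
      then have "- x\<^sup>2 / 2 \<le> - u\<^sup>2 / 2 + (- (x + u)\<^sup>2 / 2)"
        by (simp add: power2_eq_square field_simps)
      then have "exp (- x\<^sup>2 / 2) \<le> exp (- u\<^sup>2 / 2) * exp (- (x + u)\<^sup>2 / 2)"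
        unfolding exp_add[symmetric] by simp
      then show ?thesis using True by (simp add: normal_density_def divide_right_mono)
    qed (simp add: normal_density_nonneg)
  qed
  then show ?thesis by (simp add: measure_std_normal)
qed

text \<open>On the unit interval from \<open>w\<close> to \<open>w + 1\<close> the density is at
  least its value at the right end. The loss in the exponent is of lower order when \<open>w\<close>
  is large.\<close>

lemma std_normal_upper_tail_ge:
  assumes "w \<ge> 0"
  shows "exp (- (w + 1)\<^sup>2 / 2) / sqrt (2 * pi) \<le> measure std_normal_distribution {w..}"
proof -
  have "(LINT x|lborel. exp (- (w + 1)\<^sup>2 / 2) / sqrt (2 * pi) * indicator {w..w+1} x)
      \<le> (LINT x|lborel. std_normal_density x * indicator {w..} x)"
  proof (rule integral_mono)
    show "integrable lborel (\<lambda>x. std_normal_density x * indicat_real {w..} x)"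
      by (intro integrable_real_mult_indicator) auto
    show "integrable lborel (\<lambda>x. exp (- (w + 1)\<^sup>2 / 2) / sqrt (2 * pi) * indicat_real {w..w+1} x)"
      by (intro integrable_mult_right integrable_real_indicator) (auto simp: emeasure_lborel_Icc_eq)
    fix x :: real
    show "exp (- (w + 1)\<^sup>2 / 2) / sqrt (2 * pi) * indicat_real {w..w+1} x \<le> std_normal_density x * indicat_real {w..} x"
    proof (cases "x \<in> {w..w+1}")
      case True
      then have "x\<^sup>2 \<le> (w+1)\<^sup>2" using assms by (intro power_mono) auto
      then show ?thesis using True by (simp add: std_normal_density_def divide_right_mono)
    qed (simp add: normal_density_nonneg)
  qed
  then show ?thesis by (simp add: measure_std_normal)
qed

lemma measure_normal_law:
  assumes [measurable]: "A \<in> sets borel"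
  shows "measure (normal_law v) A = measure std_normal_distribution {x. sqrt v * x \<in> A}"
  unfolding normal_law_def by (subst measure_distr) (auto simp: vimage_def)

lemma normal_law_below_minus_1:
  assumes "0 \<le> v" "v \<le> 1 / K" "K > 0"
  shows "measure (normal_law v) {..< -1} \<le> exp (- K / 2)"
proof -
  interpret N: real_distribution std_normal_distribution by (rule real_dist_normal_dist)
  have "{x. sqrt v * x \<in> {..< -1}} \<subseteq> {..< - sqrt K}"
  proof (clarsimp)
    fix x assume x: "sqrt v * x < -1"
    have "sqrt v * sqrt K = sqrt (v * K)" by (simp add: real_sqrt_mult)
    also have "\<dots> \<le> 1" using assms by (simp add: field_simps)
    finally have le: "sqrt v * sqrt K \<le> 1" .
    show "x < - sqrt K"
    proof (rule ccontr)
      assume "\<not> x < - sqrt K"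
      then have "sqrt v * x \<ge> sqrt v * (- sqrt K)" using assms by (intro mult_left_mono) auto
      then show False using x le by simp
    qed
  qed
  then have "measure (normal_law v) {..< -1} \<le> measure std_normal_distribution {..< - sqrt K}"
    by (subst measure_normal_law) (auto intro!: N.finite_measure_mono)
  also have "\<dots> \<le> exp (- K / 2)"
    using std_normal_lower_tail_le[of "sqrt K"] assms by simp
  finally show ?thesis .
qed

text \<open>Combines the tail bound with 1 - q \<le> exp(-q), the form that multiplies well over
  independent variables.\<close>

lemma normal_law_below:
  assumes "v > 0" "t \<ge> 0"
  shows "measure (normal_law v) {..<t} \<le> exp (- (exp (- (t / sqrt v + 1)\<^sup>2 / 2) / sqrt (2 * pi)))"
proof -
  interpret N: real_distribution std_normal_distribution by (rule real_dist_normal_dist)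
  have "{x. sqrt v * x \<in> {..<t}} = space std_normal_distribution - {t / sqrt v..}"
    using assms by (auto simp: field_simps not_le)
  then have "measure (normal_law v) {..<t} = 1 - measure std_normal_distribution {t / sqrt v..}"
    by (simp add: measure_normal_law N.prob_compl[symmetric])
  also have "\<dots> \<le> 1 - exp (- (t / sqrt v + 1)\<^sup>2 / 2) / sqrt (2 * pi)"
    using std_normal_upper_tail_ge[of "t / sqrt v"] assms by simp
  also have "\<dots> \<le> exp (- (exp (- (t / sqrt v + 1)\<^sup>2 / 2) / sqrt (2 * pi)))"
    using exp_ge_add_one_self[of "- (exp (- (t / sqrt v + 1)\<^sup>2 / 2) / sqrt (2 * pi))"] by simp
  finally show ?thesis .
qed

text \<open>Subtracting the multiple \<open>c\<close> of the sum from an exchangeable Gaussian vector makes its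
  entries independent when \<open>(1 - n c)\<^sup>2 = (g - \<rho>) / (g - \<rho> + n \<rho>)\<close>, and then \<open>c\<close> times the sum
  has variance at most \<open>\<rho>\<close>. No independent auxiliary variable is needed.\<close>

lemma (in prob_space) exchangeable_gaussian_all_below:
  fixes X :: "nat \<Rightarrow> 'a \<Rightarrow> real"
  assumes X: "\<And>k. k < n \<Longrightarrow> X k \<in> borel_measurable M" and n: "n > 0"
    and \<rho>: "0 \<le> \<rho>" "\<rho> < g" "\<rho> \<le> 1 / K" "K > 0" and t: "t \<ge> 0"
    and char: "\<And>a. (LINT \<omega>|M. iexp (\<Sum>k<n. a k * X k \<omega>))
      = of_real (exp (- ((g - \<rho>) * (\<Sum>k<n. (a k)\<^sup>2) + \<rho> * (\<Sum>k<n. a k)\<^sup>2) / 2))"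
  shows "prob {\<omega> \<in> space M. \<forall>k<n. X k \<omega> < t}
    \<le> exp (- (real n * (exp (- ((t + 1) / sqrt (g - \<rho>) + 1)\<^sup>2 / 2) / sqrt (2 * pi)))) + exp (- K / 2)"
proof -
  \<comment> \<open>The covariance matrix has eigenvalue \<open>\<tau>\<close> on the constant
    vector and \<open>g - \<rho>\<close> on its orthogonal complement. Subtracting
    \<open>c * S\<close> scales the constant direction by \<open>1 - n * c = sqrt w\<close>, which
    brings its variance down to \<open>g - \<rho>\<close> too.\<close>
  define \<tau> where "\<tau> = g - \<rho> + n * \<rho>"
  define w where "w = (g - \<rho>) / \<tau>"
  define c where "c = (1 - sqrt w) / n"
  have nr: "n * \<rho> \<ge> 0" using \<rho> by simp
  have \<tau>: "\<tau> > 0" using \<rho> nr by (simp add: \<tau>_def add_pos_nonneg)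
  have "g - \<rho> \<le> \<tau>" using nr by (simp add: \<tau>_def)
  then have w: "0 < w" "w \<le> 1" using \<rho> \<tau> by (auto simp: w_def)
  have nc: "1 - n * c = sqrt w" using n by (simp add: c_def)
  define S where "S \<omega> = (\<Sum>k<n. X k \<omega>)" for \<omega>
  define Z where "Z k \<omega> = X k \<omega> - c * S \<omega>" for k \<omega>
  have S [measurable]: "S \<in> borel_measurable M" unfolding S_def using X by (intro borel_measurable_sum) auto
  have Z: "Z k \<in> borel_measurable M" if "k < n" for k
    unfolding Z_def using X[OF that] by measurable
  have charZ: "(LINT \<omega>|M. iexp (\<Sum>k<n. a k * Z k \<omega>)) = (\<Prod>k<n. char (normal_law (g - \<rho>)) (a k))" for a
  proof -
    define A where "A = (\<Sum>k<n. a k)"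
    define b where "b k = a k - c * A" for k
    have "(\<Sum>k<n. a k * Z k \<omega>) = (\<Sum>k<n. b k * X k \<omega>)" for \<omega>
    proof -
      have "(\<Sum>k<n. a k * Z k \<omega>) = (\<Sum>k<n. a k * X k \<omega>) - A * (c * S \<omega>)"
        by (simp add: Z_def right_diff_distrib sum_subtractf A_def sum_distrib_right)
      also have "A * (c * S \<omega>) = (\<Sum>k<n. c * A * X k \<omega>)"
        by (simp add: S_def sum_distrib_left mult_ac)
      finally show ?thesis by (simp add: b_def left_diff_distrib sum_subtractf)
    qed
    then have 1: "(LINT \<omega>|M. iexp (\<Sum>k<n. a k * Z k \<omega>))
      = of_real (exp (- ((g - \<rho>) * (\<Sum>k<n. (b k)\<^sup>2) + \<rho> * (\<Sum>k<n. b k)\<^sup>2) / 2))"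
      using char[of b] by simp
    have "(\<Sum>k<n. b k) = A - n * c * A" by (simp add: b_def sum_subtractf A_def)
    also have "\<dots> = sqrt w * A" using nc by (simp add: algebra_simps flip: nc)
    finally have sb: "(\<Sum>k<n. b k)\<^sup>2 = w * A\<^sup>2" using w by (simp add: power_mult_distrib)
    have "(\<Sum>k<n. (b k)\<^sup>2) = (\<Sum>k<n. (a k)\<^sup>2 - 2 * c * A * a k + (c * A)\<^sup>2)"
      by (intro sum.cong) (auto simp: b_def power2_eq_square algebra_simps)
    also have "\<dots> = (\<Sum>k<n. (a k)\<^sup>2) - 2 * c * A * A + n * (c * A)\<^sup>2"
      by (simp add: sum.distrib sum_subtractf A_def flip: sum_distrib_left)
    also have "\<dots> = (\<Sum>k<n. (a k)\<^sup>2) + ((1 - n * c)\<^sup>2 - 1) / n * A\<^sup>2"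
      using n by (simp add: power2_eq_square field_simps)
    also have "(1 - n * c)\<^sup>2 = w" using nc w by simp
    finally have sb2: "(\<Sum>k<n. (b k)\<^sup>2) = (\<Sum>k<n. (a k)\<^sup>2) + (w - 1) / n * A\<^sup>2" .
    \<comment> \<open>This is the coefficient of \<open>A\<^sup>2\<close> in the quadratic form of
      the \<open>Z k\<close>; once it vanishes, only the diagonal form with variance
      \<open>g - \<rho>\<close> remains.\<close>
    have "(g - \<rho>) * ((w - 1) / n) + \<rho> * w = 0"
    proof -
      have "w * \<tau> = g - \<rho>" using \<tau> by (simp add: w_def)
      then have "(g - \<rho>) * (w - 1) + n * \<rho> * w = 0" by (simp add: \<tau>_def algebra_simps)
      then show ?thesis using n by (simp add: field_simps)
    qed
    then have "((g - \<rho>) * ((w - 1) / n) + \<rho> * w) * A\<^sup>2 = 0" by simp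
    then have Q: "(g - \<rho>) * (\<Sum>k<n. (b k)\<^sup>2) + \<rho> * (\<Sum>k<n. b k)\<^sup>2 = (g - \<rho>) * (\<Sum>k<n. (a k)\<^sup>2)"
      unfolding sb sb2 by (simp add: algebra_simps)
    have "(\<Prod>k<n. char (normal_law (g - \<rho>)) (a k)) = of_real (\<Prod>k<n. exp (- ((g - \<rho>) * (a k)\<^sup>2) / 2))"
      using \<rho> by (simp add: char_normal_law)
    also have "(\<Prod>k<n. exp (- ((g - \<rho>) * (a k)\<^sup>2) / 2)) = exp (- ((g - \<rho>) * (\<Sum>k<n. (a k)\<^sup>2)) / 2)"
      by (simp add: exp_sum[symmetric] sum_distrib_left sum_divide_distrib sum_negf)
    finally show ?thesis unfolding 1 Q by simp
  qed
  define v where "v = c\<^sup>2 * n * \<tau>"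
  define R where "R \<omega> = c * S \<omega>" for \<omega>
  have R [measurable]: "R \<in> borel_measurable M" unfolding R_def by measurable
  have v0: "v \<ge> 0" using \<tau> by (simp add: v_def)
  \<comment> \<open>From w \<le> sqrt w follows
    \<open>n * c \<le> 1 - w = n * \<rho> / \<tau>\<close>, which bounds the variance
    \<open>v\<close> of \<open>c * S\<close> by \<open>\<rho> * (n * \<rho> / \<tau>)\<close>, hence
    by \<open>\<rho>\<close>.\<close>
  have "w \<le> sqrt w" using w by (simp add: real_le_rsqrt power2_eq_square mult_left_le)
  then have "n * c \<le> 1 - w" using n by (simp add: c_def)
  also have "1 - w = n * \<rho> / \<tau>" using \<tau> by (simp add: w_def \<tau>_def field_simps)
  also have "\<dots> = n * (\<rho> / \<tau>)" by simp
  finally have c1: "c \<le> \<rho> / \<tau>" using n by (simp only: mult_le_cancel_left_pos of_nat_0_less_iff)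
  have c0: "c \<ge> 0" using w by (simp add: c_def)
  have "v \<le> (\<rho> / \<tau>)\<^sup>2 * n * \<tau>" unfolding v_def using c0 c1 \<tau>
    by (intro mult_right_mono power_mono) auto
  also have "\<dots> = \<rho> * (n * \<rho> / \<tau>)" using \<tau> by (simp add: power2_eq_square)
  also have "\<dots> \<le> \<rho> * 1" using \<rho> \<tau> by (intro mult_left_mono) (auto simp: \<tau>_def)
  finally have v1: "v \<le> 1 / K" using \<rho> by simp
  have charR: "char (distr M borel R) s = char (normal_law v) s" for s
  proof -
    have "char (distr M borel R) s = (LINT \<omega>|M. iexp (s * R \<omega>))"
      unfolding char_def by (subst integral_distr) auto
    also have "\<dots> = (LINT \<omega>|M. iexp (\<Sum>k<n. (s * c) * X k \<omega>))"
      by (simp add: R_def S_def sum_distrib_left mult.assoc)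
    also have "\<dots> = of_real (exp (- ((g - \<rho>) * (\<Sum>k<n. (s * c)\<^sup>2) + \<rho> * (\<Sum>k<n. s * c)\<^sup>2) / 2))"
      by (rule char)
    also have "(g - \<rho>) * (\<Sum>k<n. (s * c)\<^sup>2) + \<rho> * (\<Sum>k<n. s * c)\<^sup>2 = v * s\<^sup>2"
      by (simp add: v_def \<tau>_def power2_eq_square algebra_simps)
    finally show ?thesis using v0 by (simp add: char_normal_law)
  qed
  interpret D: real_distribution "distr M borel R" by (intro real_distribution_distr) simp
  have "distr M borel R = normal_law v"
    using charR by (intro Levy_uniqueness D.real_distribution_axioms real_distribution_normal_law ext)
  then have "measure (normal_law v) {..< -1} = prob {\<omega> \<in> space M. R \<omega> < -1}"
    by (simp add: measure_distr vimage_def Int_def conj_commute flip: \<open>distr M borel R = normal_law v\<close>)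
  then have PR: "prob {\<omega> \<in> space M. R \<omega> < -1} \<le> exp (- K / 2)"
    using normal_law_below_minus_1[OF v0 v1] \<rho> by simp
  let ?q = "exp (- ((t + 1) / sqrt (g - \<rho>) + 1)\<^sup>2 / 2) / sqrt (2 * pi)"
  have "prob {\<omega> \<in> space M. \<forall>k<n. Z k \<omega> \<in> {..<t+1}} = measure (normal_law (g - \<rho>)) {..<t+1} ^ n"
    using charZ Z by (intro prob_all_in_if_char_product real_distribution_normal_law) auto
  also have "\<dots> \<le> exp (- ?q) ^ n"
    using normal_law_below[of "g - \<rho>" "t + 1"] \<rho> t by (intro power_mono) auto
  also have "\<dots> = exp (- (real n * ?q))" by (simp add: exp_of_nat_mult[symmetric])
  finally have PZ: "prob {\<omega> \<in> space M. \<forall>k<n. Z k \<omega> \<in> {..<t+1}} \<le> exp (- (real n * ?q))" .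
  have mZ: "{\<omega> \<in> space M. \<forall>k<n. Z k \<omega> \<in> {..<t+1}} \<in> sets M"
  proof -
    have "{\<omega> \<in> space M. \<forall>k\<in>{..<n}. Z k \<omega> \<in> {..<t+1}} \<in> sets M"
      using Z by (intro sets.sets_Collect_finite_All) (auto intro!: measurable_sets_Collect)
    also have "{\<omega> \<in> space M. \<forall>k\<in>{..<n}. Z k \<omega> \<in> {..<t+1}} = {\<omega> \<in> space M. \<forall>k<n. Z k \<omega> \<in> {..<t+1}}"
      by auto
    finally show ?thesis .
  qed
  \<comment> \<open>One unit of slack separates the two parts: unless the common part
    \<open>R\<close> drops below -1, all \<open>X k\<close> below \<open>t\<close> force all
    \<open>Z k\<close> below \<open>t + 1\<close>. A bounded shift is negligible against a level of
    order sqrt(log d).\<close>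
  have "Z k \<omega> < t + 1" if "X k \<omega> < t" "\<not> R \<omega> < -1" for k \<omega>
    using that by (simp add: Z_def R_def)
  then have sub: "{\<omega> \<in> space M. \<forall>k<n. X k \<omega> < t}
      \<subseteq> {\<omega> \<in> space M. \<forall>k<n. Z k \<omega> \<in> {..<t+1}} \<union> {\<omega> \<in> space M. R \<omega> < -1}"
    by blast
  have "prob {\<omega> \<in> space M. \<forall>k<n. X k \<omega> < t}
    \<le> prob ({\<omega> \<in> space M. \<forall>k<n. Z k \<omega> \<in> {..<t+1}} \<union> {\<omega> \<in> space M. R \<omega> < -1})"
    by (intro finite_measure_mono[OF sub] sets.Un mZ) simp
  also have "\<dots> \<le> prob {\<omega> \<in> space M. \<forall>k<n. Z k \<omega> \<in> {..<t+1}} + prob {\<omega> \<in> space M. R \<omega> < -1}"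
    by (intro measure_Un_le mZ) simp
  finally show ?thesis using PZ PR by linarith
qed

section \<open>Trees in the level set\<close>

lemma flip_in_hypercube:
  assumes "v \<in> hypercube d" "i < d"
  shows "flip v i \<in> hypercube d"
proof -
  have "set (flip v i) \<subseteq> insert (1 - v ! i) (set v)"
    unfolding flip_def by (rule set_update_subset_insert)
  then show ?thesis using assms hypercube_nth[OF assms] by (auto simp: hypercube_def)
qed

lemma nbr_flip:
  assumes "v \<in> hypercube d" "i < d"
  shows "nbr v (flip v i)"
proof -
  have "flip v i = v[i := v ! i + (1 - 2 * v ! i)]" by (simp add: flip_def)
  then show ?thesis using nbr_update[of i v "1 - 2 * v ! i"] assms hypercube_nth[OF assms]
    by (auto simp: hypercube_length)
qed

lemma nbr_sym: "nbr x y \<Longrightarrow> nbr y x"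
  by (auto simp: nbr_def abs_minus_commute)

lemma nth_flip: "i < length v \<Longrightarrow> flip v i ! j = (if j = i then 1 - v ! i else v ! j)"
  by (simp add: flip_def nth_list_update)

lemma one_minus_ne: "1 - (z::int) \<noteq> z"
  by presburger

lemma flip_inject:
  assumes "i < length v" "j < length v" "flip v i = flip v j"
  shows "i = j"
proof (rule ccontr)
  assume "i \<noteq> j"
  moreover have "flip v i ! i = flip v j ! i" using assms(3) by simp
  ultimately show False using assms(1,2) one_minus_ne[of "v ! i"] by (simp add: nth_flip)
qed

lemma finite_hypercube: "finite (hypercube d)"
proof -
  have "hypercube d = {xs. set xs \<subseteq> {0, 1} \<and> length xs = d}" by (auto simp: hypercube_def)
  then show ?thesis using finite_lists_length_eq[of "{0, 1::int}" d] by simp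
qed

section \<open>The field at the cube neighbours of a vertex\<close>

lemma measurable_coordinate:
  assumes "gff_law d P"
  shows "(\<lambda>\<omega>. \<omega> x) \<in> borel_measurable P"
proof -
  have "sets P = sets (Pi\<^sub>M UNIV (\<lambda>_::int list. borel :: real measure))"
    using assms by (simp add: gff_law_def)
  then show ?thesis by (subst measurable_cong_sets[OF _ refl]) (auto intro: measurable_component_singleton)
qed

lemma exchangeable_quadratic_form:
  fixes g \<rho> :: real and n :: nat
  shows "(\<Sum>k<n. \<Sum>l<n. a k * a l * (if k = l then g else \<rho>)) = (g - \<rho>) * (\<Sum>k<n. (a k)\<^sup>2) + \<rho> * (\<Sum>k<n. a k)\<^sup>2"
proof -
  have "(\<Sum>l<n. a k * a l * (if k = l then g else \<rho>)) = (g - \<rho>) * (a k)\<^sup>2 + \<rho> * (a k * (\<Sum>l<n. a l))"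
    if "k < n" for k
  proof -
    have "(\<Sum>l<n. a k * a l * (if k = l then g else \<rho>))
        = (\<Sum>l<n. (if k = l then (g - \<rho>) * (a k)\<^sup>2 else 0) + \<rho> * (a k * a l))"
      by (intro sum.cong) (auto simp: power2_eq_square algebra_simps)
    also have "\<dots> = (g - \<rho>) * (a k)\<^sup>2 + (\<Sum>l<n. \<rho> * (a k * a l))"
      using that by (subst sum.distrib, subst sum.delta') auto
    finally show ?thesis by (simp add: sum_distrib_left)
  qed
  then have "(\<Sum>k<n. \<Sum>l<n. a k * a l * (if k = l then g else \<rho>))
      = (\<Sum>k<n. (g - \<rho>) * (a k)\<^sup>2 + \<rho> * (a k * (\<Sum>l<n. a l)))" by simp
  then show ?thesis
    by (simp add: sum.distrib power2_eq_square flip: sum_distrib_left sum_distrib_right)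
qed

text \<open>By symmetry the neighbours share one variance \<open>g\<close> and one covariance
  \<open>\<rho>\<close>, so the exchangeable estimate applies with \<open>K = d - 1\<close>. The
  bounds \<open>g \<ge> 1\<close> and \<open>\<rho> \<le> 1 / (d - 1)\<close> then replace
  \<open>g - \<rho>\<close> by an explicit quantity.\<close>

lemma prob_all_flips_below:
  assumes P: "gff_law d P" and v: "v \<in> hypercube d" and d: "d \<ge> 25"
    and L: "L > 0" "p + L \<le> d" and t: "t \<ge> 0"
  shows "measure P {\<omega> \<in> space P. \<forall>k<L. \<omega> (flip v (p + k)) < t}
    \<le> exp (- (real L * (exp (- ((t + 1) / sqrt (1 - 1 / (real d - 1)) + 1)\<^sup>2 / 2) / sqrt (2 * pi))))
      + exp (- (real d - 1) / 2)"
proof -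
  interpret prob_space P using P by (simp add: gff_law_def)
  define u where "u k = flip v (p + k)" for k
  define g where "g = green (flip v 0) (flip v 0)"
  define \<rho> where "\<rho> = green (flip v 0) (flip v 1)"
  have len: "length v = d" using v by (simp add: hypercube_length)
  have inj: "inj_on u {..<L}"
    using L len by (auto simp: inj_on_def u_def dest!: flip_inject[rotated 2])
  have ne: "flip v 0 \<noteq> flip v 1" using flip_inject[of 0 v 1] len d by auto
  have \<rho>: "0 \<le> \<rho>" "\<rho> \<le> 1 / (real d - 1)"
    using green_nonneg[of "flip v 0" d "flip v 1"] green_off_diag_le[of "flip v 0" d "flip v 1"] ne len d
    by (auto simp: \<rho>_def)
  have g: "g \<ge> 1" using green_diag_ge_1[of "flip v 0" d] len d by (simp add: g_def)
  have small: "1 / (real d - 1) < 1" using d by simp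
  have green_u: "green (u k) (u l) = (if k = l then g else \<rho>)" if "k < L" "l < L" for k l
    using green_flip_diag[OF v, of "p + k" 0] green_flip_off_diag[OF v, of "p + k" "p + l" 0 1] that L d
    by (auto simp: u_def g_def \<rho>_def)
  have char: "(LINT \<omega>|P. iexp (\<Sum>k<L. a k * \<omega> (u k)))
      = of_real (exp (- ((g - \<rho>) * (\<Sum>k<L. (a k)\<^sup>2) + \<rho> * (\<Sum>k<L. a k)\<^sup>2) / 2))" for a
  proof -
    \<comment> \<open>\<open>gff_law\<close> takes coefficients indexed by lattice points;
      injectivity of \<open>u\<close> carries them over from the indices.\<close>
    define a' where "a' y = a (the_inv_into {..<L} u y)" for y
    have a': "a' (u k) = a k" if "k < L" for k
      using inj that by (simp add: a'_def the_inv_into_f_f)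
    have S: "finite (u ` {..<L})" "u ` {..<L} \<subseteq> lattice d"
      using len by (auto simp: u_def lattice_def)
    have "(LINT \<omega>|P. iexp (\<Sum>y\<in>u ` {..<L}. a' y * \<omega> y))
      = of_real (exp (- (\<Sum>y\<in>u ` {..<L}. \<Sum>z\<in>u ` {..<L}. a' y * a' z * green y z) / 2))"
      using P S unfolding gff_law_def by blast
    also have "(\<Sum>y\<in>u ` {..<L}. \<Sum>z\<in>u ` {..<L}. a' y * a' z * green y z)
      = (\<Sum>k<L. \<Sum>l<L. a k * a l * (if k = l then g else \<rho>))"
      by (simp add: sum.reindex[OF inj] a' green_u)
    finally show ?thesis by (simp add: sum.reindex[OF inj] a' exchangeable_quadratic_form)
  qed
  define w where "w = (t + 1) / sqrt (g - \<rho>)"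
  define w' where "w' = (t + 1) / sqrt (1 - 1 / (real d - 1))"
  have "sqrt (1 - 1 / (real d - 1)) \<le> sqrt (g - \<rho>)" using \<rho> g by simp
  moreover have "0 < sqrt (1 - 1 / (real d - 1))" using small by simp
  ultimately have w: "w \<le> w'" unfolding w_def w'_def using t
    by (intro divide_left_mono mult_pos_pos) auto
  have w0: "w \<ge> 0" unfolding w_def using t g \<rho> small by simp
  have q: "exp (- (w' + 1)\<^sup>2 / 2) / sqrt (2 * pi) \<le> exp (- (w + 1)\<^sup>2 / 2) / sqrt (2 * pi)"
    using w w0 by (intro divide_right_mono) (auto intro!: power_mono)
  have "\<rho> < g" using \<rho> g small by linarith
  then have "prob {\<omega> \<in> space P. \<forall>k<L. \<omega> (u k) < t}
      \<le> exp (- (real L * (exp (- (w + 1)\<^sup>2 / 2) / sqrt (2 * pi)))) + exp (- (real d - 1) / 2)"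
    unfolding w_def using \<rho> L(1) t d measurable_coordinate[OF P]
    by (intro exchangeable_gaussian_all_below[OF _ _ _ _ _ _ _ char]) auto
  also have "\<dots> \<le> exp (- (real L * (exp (- (w' + 1)\<^sup>2 / 2) / sqrt (2 * pi)))) + exp (- (real d - 1) / 2)"
    using mult_left_mono[OF q, of "real L"] by simp
  finally show ?thesis by (simp add: u_def w'_def)
qed

text \<open>Flips may repeat a coordinate. The set does not depend on the field and contains every
  vertex the random tree can have in generation \<open>k\<close>, so it can carry a union
  bound.\<close>

fun flips :: "nat \<Rightarrow> int list \<Rightarrow> nat \<Rightarrow> int list set" where
  "flips d x 0 = {x}"
| "flips d x (Suc k) = (\<Union>v\<in>flips d x k. flip v ` {..<d})"

lemma finite_flips: "finite (flips d x k)"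
  by (induction k) auto

lemma card_flips_le: "card (flips d x k) \<le> d ^ k"
proof (induction k)
  case (Suc k)
  have "card (flips d x (Suc k)) \<le> (\<Sum>v\<in>flips d x k. card (flip v ` {..<d}))"
    by (simp add: card_UN_le finite_flips)
  also have "\<dots> \<le> (\<Sum>v\<in>flips d x k. d)"
    using card_image_le[of "{..<d}"] by (intro sum_mono) auto
  also have "\<dots> \<le> d ^ Suc k" using Suc by simp
  finally show ?case .
qed simp

lemma flips_subset_hypercube:
  "x \<in> hypercube d \<Longrightarrow> flips d x k \<subseteq> hypercube d"
  by (induction k) (auto intro: flip_in_hypercube)

text \<open>Every point is joined to the hub \<open>v\<close> through the neighbour of
  \<open>v\<close> in its own piece, and symmetry of \<open>nbr\<close> lets two such paths be
  concatenated.\<close>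

lemma nn_connected_star:
  assumes "\<And>C. C \<in> \<C> \<Longrightarrow> nn_connected C"
    and "\<And>C. C \<in> \<C> \<Longrightarrow> \<exists>u\<in>C. nbr v u"
  shows "nn_connected (insert v (\<Union>\<C>))"
proof -
  define U where "U = insert v (\<Union>\<C>)"
  define R where "R = {(a, b). a \<in> U \<and> b \<in> U \<and> nbr a b}"
  have "sym R" by (auto simp: sym_def R_def intro: nbr_sym)
  then have symR: "sym (R\<^sup>*)" by (rule sym_rtrancl)
  have hub: "(v, a) \<in> R\<^sup>*" if a: "a \<in> U" for a
  proof (cases "a = v")
    case False
    then obtain C where C: "C \<in> \<C>" "a \<in> C" using a unfolding U_def by blast
    then obtain u where u: "u \<in> C" "nbr v u" using assms(2) by blast
    have "(u, a) \<in> {(x, y). x \<in> C \<and> y \<in> C \<and> nbr x y}\<^sup>*"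
      using assms(1)[OF C(1)] u C unfolding nn_connected_def by blast
    also have "\<dots> \<subseteq> R\<^sup>*" using C by (intro rtrancl_mono) (auto simp: R_def U_def)
    finally have "(u, a) \<in> R\<^sup>*" .
    moreover have "(v, u) \<in> R" using u C by (auto simp: R_def U_def)
    ultimately show ?thesis by (rule converse_rtrancl_into_rtrancl[rotated])
  qed simp
  have "(a, b) \<in> R\<^sup>*" if "a \<in> U" "b \<in> U" for a b
    using hub[OF that(1)] hub[OF that(2)] symR by (meson rtrancl_trans symD)
  then show ?thesis unfolding nn_connected_def U_def R_def by simp
qed

text \<open>The coordinates are cut into consecutive intervals of length \<open>L\<close>, \<open>s\<close> of them for each
  generation \<open>k\<close>; the \<open>j\<close>-th child of a vertex of generation \<open>k\<close> flips a coordinate of interval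
  \<open>k * s + j\<close>. Hence all descendants of a vertex of generation \<open>k\<close> agree with it below
  \<open>k * s * L\<close>, which keeps the subtrees disjoint.\<close>

lemma subtree_exists:
  assumes x: "x \<in> hypercube d" and size: "Suc m * s * L \<le> d"
    and good: "\<And>k v j. k \<le> m \<Longrightarrow> v \<in> flips d x k \<Longrightarrow> j < s
        \<Longrightarrow> \<exists>i<L. flip v ((k * s + j) * L + i) \<in> K"
    and "k + r = Suc m" "v \<in> flips d x k" "v \<in> K"
  shows "\<exists>C. finite C \<and> v \<in> C \<and> C \<subseteq> K \<and> nn_connected C \<and> s ^ r \<le> card C
      \<and> (\<forall>u\<in>C. \<forall>i<k * s * L. u ! i = v ! i)"
  using assms(4-6)
proof (induction r arbitrary: k v)
  case 0
  then show ?case by (intro exI[of _ "{v}"]) (auto simp: nn_connected_def)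
next
  case (Suc r)
  then have k: "k \<le> m" and v: "v \<in> hypercube d" and len: "length v = d"
    using flips_subset_hypercube[OF x, of k] by (auto simp: hypercube_length)
  have "\<exists>i<L. flip v ((k * s + j) * L + i) \<in> K" if "j < s" for j
    using good[OF k Suc.prems(2) that] .
  then obtain c where c: "\<And>j. j < s \<Longrightarrow> c j < L \<and> flip v ((k * s + j) * L + c j) \<in> K" by metis
  define i where "i j = (k * s + j) * L + c j" for j
  have i_less: "i j < Suc k * s * L" if "j < s" for j
  proof -
    have "i j < (k * s + j) * L + L" using c[OF that] by (simp add: i_def)
    also have "\<dots> = (k * s + Suc j) * L" by (simp add: algebra_simps)
    also have "\<dots> \<le> (k * s + s) * L" using that by (intro mult_right_mono) auto
    finally show ?thesis by (simp add: algebra_simps)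
  qed
  have "Suc k * s * L \<le> Suc m * s * L" using k by (intro mult_right_mono) auto
  then have i_d: "i j < d" if "j < s" for j using i_less[OF that] size by linarith
  have i_ge: "k * s * L \<le> i j" for j by (simp add: i_def algebra_simps)
  \<comment> \<open>As \<open>c j < L\<close>, division by \<open>L\<close> recovers the interval
    number, so different children flip different coordinates.\<close>
  have i_inj: "j = j'" if "j < s" "j' < s" "i j = i j'" for j j'
  proof -
    have "i j div L = k * s + j" if "j < s" for j
      using c[OF that] by (simp add: i_def)
    then show ?thesis using that by (metis add_left_cancel)
  qed
  have "\<exists>C. finite C \<and> flip v (i j) \<in> C \<and> C \<subseteq> K \<and> nn_connected C \<and> s ^ r \<le> card C
      \<and> (\<forall>u\<in>C. \<forall>l<Suc k * s * L. u ! l = flip v (i j) ! l)" if "j < s" for j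
    using Suc.prems c[OF that] i_d[OF that] by (intro Suc.IH) (auto simp: i_def)
  then obtain C where C: "\<And>j. j < s \<Longrightarrow> finite (C j) \<and> flip v (i j) \<in> C j \<and> C j \<subseteq> K \<and> nn_connected (C j)
      \<and> s ^ r \<le> card (C j) \<and> (\<forall>u\<in>C j. \<forall>l<Suc k * s * L. u ! l = flip v (i j) ! l)" by metis
  have agree: "u ! l = flip v (i j) ! l" if "j < s" "u \<in> C j" "l < Suc k * s * L" for u j l
    using C that by blast
  define U where "U = insert v (\<Union>(C ` {..<s}))"
  have "nn_connected U" unfolding U_def
  proof (rule nn_connected_star)
    fix D assume "D \<in> C ` {..<s}"
    then obtain j where j: "j < s" "D = C j" by blast
    show "nn_connected D" using C[OF j(1)] j(2) by blast
    show "\<exists>u\<in>D. nbr v u" using C[OF j(1)] j nbr_flip[OF v i_d[OF j(1)]] by blast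
  qed
  moreover have "finite U" "v \<in> U" "U \<subseteq> K" using C Suc.prems by (auto simp: U_def)
  moreover have "u ! l = v ! l" if "u \<in> U" "l < k * s * L" for u l
  proof (cases "u = v")
    case False
    then obtain j where j: "j < s" "u \<in> C j" using \<open>u \<in> U\<close> by (auto simp: U_def)
    have "l < Suc k * s * L" using that by (simp add: algebra_simps)
    moreover have "l \<noteq> i j" using that i_ge[of j] by simp
    ultimately show ?thesis using agree[OF j] i_d[OF j(1)] len by (simp add: nth_flip)
  qed simp
  moreover have "s ^ Suc r \<le> card U"
  proof -
    \<comment> \<open>Coordinate \<open>i j\<close> is flipped throughout \<open>C j\<close> and
      unflipped throughout \<open>C j'\<close>, since it lies in the range that both subtrees leave
      as in their roots.\<close>
    have disj: "C j \<inter> C j' = {}" if "j < s" "j' < s" "j \<noteq> j'" for j j'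
    proof (rule ccontr)
      assume "C j \<inter> C j' \<noteq> {}"
      then obtain u where u: "u \<in> C j" "u \<in> C j'" by blast
      have "flip v (i j) ! i j = flip v (i j') ! i j"
        using agree[OF that(1) u(1) i_less[OF that(1)]] agree[OF that(2) u(2) i_less[OF that(1)]] by simp
      moreover have "i j \<noteq> i j'" using i_inj that by blast
      ultimately show False using i_d that len one_minus_ne[of "v ! i j"] by (simp add: nth_flip)
    qed
    have "s ^ Suc r = (\<Sum>j<s. s ^ r)" by simp
    also have "\<dots> \<le> (\<Sum>j<s. card (C j))" using C by (intro sum_mono) auto
    also have "\<dots> = card (\<Union>(C ` {..<s}))"
      using C disj by (intro card_UN_disjoint[symmetric]) auto
    also have "\<dots> \<le> card U" using \<open>finite U\<close> by (intro card_mono) (auto simp: U_def)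
    finally show ?thesis .
  qed
  ultimately show ?case by blast
qed

text \<open>The vertex \<open>x\<close> itself need not lie in \<open>K\<close>. Interval 0 of
  generation 0 supplies a neighbour in \<open>K\<close>, which becomes the root, and the
  \<open>m\<close> generations below it give the count.\<close>

lemma component_exists:
  assumes x: "x \<in> hypercube d" and size: "Suc m * s * L \<le> d" and s: "s \<ge> 1"
    and good: "\<And>k v j. k \<le> m \<Longrightarrow> v \<in> flips d x k \<Longrightarrow> j < s
        \<Longrightarrow> \<exists>i<L. flip v ((k * s + j) * L + i) \<in> K"
  shows "\<exists>y C. nbr x y \<and> y \<in> C \<and> C \<subseteq> K \<and> nn_connected C \<and> s ^ m \<le> card C"
proof -
  obtain i where i: "i < L" "flip x i \<in> K" using good[of 0 x 0] s by auto
  have "L \<le> Suc m * s * L" using s by simp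
  then have "i < d" using i size by linarith
  then have "flip x i \<in> flips d x 1" "nbr x (flip x i)" using nbr_flip[OF x] by auto
  then show ?thesis using subtree_exists[OF x size good, of 1 m "flip x i"] i by auto
qed

section \<open>Measurability of the event and the union bound\<close>

lemma substantial_event_eq:
  assumes "gff_law d P"
  shows "{\<omega> \<in> space P. \<exists>y. nbr x y \<and> (\<exists>C. y \<in> C \<and> substantial_comp \<epsilon> d (hypercube d \<inter> level_set \<omega> d h) C)}
    = (\<Union>C\<in>{C. C \<subseteq> hypercube d \<and> nn_connected C \<and> (\<exists>y\<in>C. nbr x y) \<and>
        real (card C) \<ge> real_of_int \<lfloor>real d powr \<epsilon> / bconst \<epsilon>\<rfloor> powr (bconst \<epsilon> - 1)}.
          {\<omega> \<in> space P. \<forall>z\<in>C. h \<le> \<omega> z})"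
proof -
  have "C \<subseteq> hypercube d \<inter> level_set \<omega> d h \<longleftrightarrow> C \<subseteq> hypercube d \<and> (\<forall>z\<in>C. h \<le> \<omega> z)" for C \<omega>
    by (auto simp: level_set_def lattice_def hypercube_def)
  then show ?thesis by (auto simp: substantial_comp_def)
qed

text \<open>Passing to the complement in the union bound requires a measurable event. It is a finite
  union, because the components are subsets of the finite cube.\<close>

lemma substantial_event_measurable:
  assumes P: "gff_law d P"
  shows "{\<omega> \<in> space P. \<exists>y. nbr x y \<and> (\<exists>C. y \<in> C \<and> substantial_comp \<epsilon> d (hypercube d \<inter> level_set \<omega> d h) C)} \<in> sets P"
  unfolding substantial_event_eq[OF P]
proof (intro sets.finite_UN)
  show "finite {C. C \<subseteq> hypercube d \<and> nn_connected C \<and> (\<exists>y\<in>C. nbr x y) \<and>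
        real (card C) \<ge> real_of_int \<lfloor>real d powr \<epsilon> / bconst \<epsilon>\<rfloor> powr (bconst \<epsilon> - 1)}"
    by (rule finite_subset[of _ "Pow (hypercube d)"]) (auto simp: finite_hypercube)
  fix C assume "C \<in> {C. C \<subseteq> hypercube d \<and> nn_connected C \<and> (\<exists>y\<in>C. nbr x y) \<and>
        real (card C) \<ge> real_of_int \<lfloor>real d powr \<epsilon> / bconst \<epsilon>\<rfloor> powr (bconst \<epsilon> - 1)}"
  then have "finite C" using finite_hypercube finite_subset by auto
  moreover have "{\<omega> \<in> space P. h \<le> \<omega> z} \<in> sets P" for z
    using measurable_coordinate[OF P, of z] by measurable
  ultimately show "{\<omega> \<in> space P. \<forall>z\<in>C. h \<le> \<omega> z} \<in> sets P"
    by (intro sets.sets_Collect_finite_All) auto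
qed

text \<open>If every interval at every possible tree vertex contains a flip above the level, the
  tree construction succeeds; so failure lies in the union of the events \<open>bad\<close>, each
  covered by \<open>prob_all_flips_below\<close>.\<close>

lemma prob_no_substantial_le:
  assumes P: "gff_law d P" and x: "x \<in> hypercube d" and d: "d \<ge> 25" and h: "h \<ge> 0"
    and s: "s \<ge> 1" and L: "L \<ge> 1" and size: "Suc m * s * L \<le> d"
    and large: "real_of_int \<lfloor>real d powr \<epsilon> / bconst \<epsilon>\<rfloor> powr (bconst \<epsilon> - 1) \<le> real (s ^ m)"
  shows "1 - measure P {\<omega> \<in> space P. \<exists>y. nbr x y \<and>
      (\<exists>C. y \<in> C \<and> substantial_comp \<epsilon> d (hypercube d \<inter> level_set \<omega> d h) C)}
    \<le> real ((Suc m)\<^sup>2 * d ^ m * s) *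
      (exp (- (real L * (exp (- ((h + 1) / sqrt (1 - 1 / (real d - 1)) + 1)\<^sup>2 / 2) / sqrt (2 * pi))))
      + exp (- (real d - 1) / 2))"
    (is "1 - measure P ?E \<le> _ * ?b")
proof -
  interpret prob_space P using P by (simp add: gff_law_def)
  define V where "V = (\<Union>k\<le>m. flips d x k)"
  \<comment> \<open>All vertices of \<open>V\<close> are paired with all generations, whatever their
    own; this costs only a factor \<open>Suc m\<close> and explains the square in the bound.\<close>
  define I where "I = {..m} \<times> V \<times> {..<s}"
  define bad where "bad = (\<lambda>(k, v, j). {\<omega> \<in> space P. \<forall>i<L. \<omega> (flip v ((k * s + j) * L + i)) < h})"
  have "finite V" by (simp add: V_def finite_flips)
  then have finI: "finite I" by (simp add: I_def)
  have VH: "V \<subseteq> hypercube d" using flips_subset_hypercube[OF x] by (auto simp: V_def)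
  have "card V \<le> (\<Sum>k\<le>m. card (flips d x k))" unfolding V_def by (intro card_UN_le) simp
  also have "\<dots> \<le> (\<Sum>k\<le>m. d ^ m)"
    using card_flips_le d by (intro sum_mono) (meson atMost_iff le_trans one_le_numeral power_increasing)
  finally have "card V \<le> Suc m * d ^ m" by simp
  then have "card I \<le> Suc m * (Suc m * d ^ m * s)"
    by (simp add: I_def card_cartesian_product del: mult_Suc)
  then have cardI: "card I \<le> (Suc m)\<^sup>2 * d ^ m * s"
    by (simp only: power2_eq_square mult_ac)
  have index: "(k * s + j) * L + L \<le> d" if "k \<le> m" "j < s" for k j
  proof -
    have "(k * s + j) * L + L = (k * s + Suc j) * L" by simp
    also have "\<dots> \<le> (m * s + s) * L" using that by (intro mult_right_mono add_mono) auto
    also have "\<dots> = Suc m * s * L" by simp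
    finally show ?thesis using size by linarith
  qed
  have bad_sets: "bad p \<in> sets P" for p
  proof -
    obtain k v j where p: "p = (k, v, j)" using prod_cases3 by blast
    have "{\<omega> \<in> space P. \<omega> z < h} \<in> sets P" for z
      using measurable_coordinate[OF P, of z] by measurable
    then have "{\<omega> \<in> space P. \<forall>i\<in>{..<L}. \<omega> (flip v ((k * s + j) * L + i)) < h} \<in> sets P"
      by (intro sets.sets_Collect_finite_All) auto
    moreover have "bad p = {\<omega> \<in> space P. \<forall>i\<in>{..<L}. \<omega> (flip v ((k * s + j) * L + i)) < h}"
      unfolding bad_def p by auto
    ultimately show ?thesis by simp
  qed
  have bad_le: "prob (bad p) \<le> ?b" if "p \<in> I" for p
  proof -
    obtain k v j where p: "p = (k, v, j)" using prod_cases3 by blast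
    then have "k \<le> m" "v \<in> hypercube d" "j < s" using that VH by (auto simp: I_def)
    then show ?thesis unfolding p bad_def prod.case
      using P d L h index by (intro prob_all_flips_below) auto
  qed
  have "space P - ?E \<subseteq> (\<Union>p\<in>I. bad p)"
  proof
    fix \<omega> assume \<omega>: "\<omega> \<in> space P - ?E"
    show "\<omega> \<in> (\<Union>p\<in>I. bad p)"
    proof (rule ccontr)
      assume nb: "\<omega> \<notin> (\<Union>p\<in>I. bad p)"
      have "\<exists>i<L. flip v ((k * s + j) * L + i) \<in> hypercube d \<inter> level_set \<omega> d h"
        if "k \<le> m" "v \<in> flips d x k" "j < s" for k v j
      proof -
        have "(k, v, j) \<in> I" using that by (auto simp: I_def V_def)
        then have "\<omega> \<notin> bad (k, v, j)" using nb by blast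
        then obtain i where i: "i < L" "\<not> \<omega> (flip v ((k * s + j) * L + i)) < h"
          using \<omega> by (auto simp: bad_def)
        have "v \<in> hypercube d" using that VH by (auto simp: V_def)
        then have "flip v ((k * s + j) * L + i) \<in> hypercube d"
          using index[OF that(1,3)] i by (intro flip_in_hypercube) auto
        then show ?thesis using i by (auto simp: level_set_def lattice_def hypercube_def)
      qed
      from component_exists[OF x size s this]
      obtain y C where yC: "nbr x y" "y \<in> C" "C \<subseteq> hypercube d \<inter> level_set \<omega> d h" "nn_connected C"
          "s ^ m \<le> card C" by blast
      have "real (s ^ m) \<le> real (card C)" using yC(5) by (simp only: of_nat_le_iff)
      then have "substantial_comp \<epsilon> d (hypercube d \<inter> level_set \<omega> d h) C"
        using yC large unfolding substantial_comp_def by linarith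
      then show False using \<omega> yC by blast
    qed
  qed
  then have "prob (space P - ?E) \<le> prob (\<Union>p\<in>I. bad p)"
    using finI bad_sets by (intro finite_measure_mono) auto
  also have "\<dots> \<le> (\<Sum>p\<in>I. prob (bad p))" using finI bad_sets by (intro measure_UNION_le) auto
  also have "\<dots> \<le> real (card I) * ?b" using bad_le by (intro sum_bounded_above) auto
  also have "\<dots> \<le> real ((Suc m)\<^sup>2 * d ^ m * s) * ?b"
    using cardI by (intro mult_right_mono) (auto simp del: of_nat_mult)
  finally show ?thesis using prob_compl[OF substantial_event_measurable[OF P]] by simp
qed

section \<open>Asymptotics in the dimension\<close>

text \<open>The exponent of the single-variable tail in \<open>prob_all_flips_below\<close>, taken
  at \<open>\<beta>\<close> times the upper bound for \<open>h_as\<close> and with the dimension as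
  a real variable \<open>x\<close>.\<close>

definition tail_exponent :: "real \<Rightarrow> real \<Rightarrow> real" where
  "tail_exponent \<beta> x
    = ((sqrt (2 * (1 + 1 / (x - 1)) * ln x) * \<beta> + 1) / sqrt (1 - 1 / (x - 1)) + 1)\<^sup>2 / 2"

text \<open>Half the square of \<open>\<beta> * sqrt (2 * ln x)\<close> is
  \<open>\<beta>\<^sup>2 * ln x\<close>; the unit shifts and the corrections by
  \<open>1 / (x - 1)\<close> are of lower order.\<close>

lemma tail_exponent_asymp:
  assumes "\<beta> > 0"
  shows "((\<lambda>x. tail_exponent \<beta> x / ln x) \<longlongrightarrow> \<beta>\<^sup>2) at_top"
proof -
  have "((\<lambda>x. tail_exponent \<beta> x / ln x) \<longlongrightarrow> (2 powr (1 / 2) * \<beta>)\<^sup>2 / 2) at_top"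
    unfolding tail_exponent_def using assms by real_asymp
  then show ?thesis by (simp add: power_mult_distrib powr_half_sqrt)
qed

lemma tail_exponent_le:
  assumes "\<beta> > 0" "\<beta>\<^sup>2 < \<delta>"
  shows "eventually (\<lambda>x. tail_exponent \<beta> x \<le> \<delta> * ln x) at_top"
proof -
  have "eventually (\<lambda>x. tail_exponent \<beta> x / ln x < \<delta>) at_top"
    using tail_exponent_asymp[OF assms(1)] assms(2) by (rule order_tendstoD)
  moreover have "eventually (\<lambda>x::real. x > 1) at_top" by (rule eventually_gt_at_top)
  ultimately show ?thesis by eventually_elim (simp add: field_simps)
qed

text \<open>A power \<open>\<gamma>\<close> above \<open>\<epsilon>\<close> in the exponent absorbs
  both the polynomial count and the target. The factor 1/2 leaves room for the second term, which
  comes from the common part of the field.\<close>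

lemma union_bound_group_term:
  fixes \<gamma> \<epsilon> M n :: real
  assumes "0 < \<epsilon>" "\<epsilon> < \<gamma>" "M > 0" "n > 0"
  shows "eventually (\<lambda>x. M\<^sup>2 * x powr n * exp (- ((x powr \<gamma> / M - 1) / sqrt (2 * pi)))
    \<le> exp (- (x powr \<epsilon>)) / 2) at_top"
  using assms by real_asymp

lemma union_bound_common_term:
  fixes \<epsilon> M n :: real
  assumes "0 < \<epsilon>" "\<epsilon> < 1" "M > 0" "n > 0"
  shows "eventually (\<lambda>x. M\<^sup>2 * x powr n * exp (- (x - 1) / 2) \<le> exp (- (x powr \<epsilon>)) / 2) at_top"
  using assms by real_asymp

section \<open>The level and the choice of exponents\<close>

lemma h_as_bounds:
  assumes "d \<ge> 25"
  shows "0 \<le> h_as d" "h_as d \<le> sqrt (2 * (1 + 1 / (real d - 1)) * ln (real d))"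
proof -
  have o: "length (origin d) = d" by (simp add: origin_def)
  have g: "1 \<le> green (origin d) (origin d)" "green (origin d) (origin d) \<le> 1 + 1 / (real d - 1)"
    using green_diag_ge_1[OF o assms] green_diag_le[OF o assms] by auto
  have "ln (real d) \<ge> 0" using assms by simp
  then show "0 \<le> h_as d" "h_as d \<le> sqrt (2 * (1 + 1 / (real d - 1)) * ln (real d))"
    using g unfolding h_as_def by (auto intro!: mult_nonneg_nonneg mult_right_mono)
qed

text \<open>The exponent \<open>1 - \<epsilon>\<close> of the interval length minus a tail exponent
  with margin \<open>\<epsilon> / 3\<close> equals
  \<open>(8/3) * \<epsilon> - 4 * \<epsilon>\<^sup>2\<close>. This exceeds \<open>\<epsilon>\<close>
  because \<open>\<epsilon> < 1/3\<close> makes \<open>4 * \<epsilon>\<^sup>2\<close> smaller than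
  \<open>(4/3) * \<epsilon>\<close>.\<close>

lemma tail_parameters:
  fixes \<epsilon> :: real
  assumes "0 < \<epsilon>" "\<epsilon> < 1/3"
  shows "0 < 1 - 2 * \<epsilon>" "0 < (1 - 2 * \<epsilon>)\<^sup>2 + \<epsilon> / 3" "\<epsilon> < 1 - \<epsilon> - ((1 - 2 * \<epsilon>)\<^sup>2 + \<epsilon> / 3)"
proof -
  show "0 < 1 - 2 * \<epsilon>" using assms by simp
  show "0 < (1 - 2 * \<epsilon>)\<^sup>2 + \<epsilon> / 3" using assms by (intro add_nonneg_pos) auto
  have "\<epsilon> * \<epsilon> < \<epsilon> * (1/3)" using assms by (intro mult_strict_left_mono) auto
  then show "\<epsilon> < 1 - \<epsilon> - ((1 - 2 * \<epsilon>)\<^sup>2 + \<epsilon> / 3)"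
    by (simp add: power2_eq_square algebra_simps) (use assms in linarith)
qed

lemma substantial_large_d:
  fixes \<epsilon> :: real
  assumes \<epsilon>: "0 < \<epsilon>" "\<epsilon> < 1/3"
  shows "\<exists>d\<^sub>0. \<forall>d\<ge>d\<^sub>0. \<forall>x\<in>hypercube d. \<forall>P. gff_law d P \<longrightarrow>
      1 - exp (- (real d powr \<epsilon>)) \<le> measure P {\<omega> \<in> space P. \<exists>y. nbr x y \<and>
          (\<exists>C. y \<in> C \<and> substantial_comp \<epsilon> d
                 (hypercube d \<inter> level_set \<omega> d (h_as d * (1 - 2 * \<epsilon>))) C)}"
proof -
  \<comment> \<open>Since \<open>bconst \<epsilon> - 1 = 11 / \<epsilon>\<close>, depth
    \<open>m\<close> makes \<open>s ^ m\<close> large enough. \<open>M\<close> is both the number of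
    generations of intervals and the degree of the polynomial count.\<close>
  define m where "m = nat \<lceil>11 / \<epsilon>\<rceil>"
  define M where "M = real (Suc m)"
  define \<beta> where "\<beta> = 1 - 2 * \<epsilon>"
  define \<delta> where "\<delta> = \<beta>\<^sup>2 + \<epsilon> / 3"
  define \<gamma> where "\<gamma> = 1 - \<epsilon> - \<delta>"
  have par: "\<beta> > 0" "\<delta> > 0" "\<epsilon> < \<gamma>" using tail_parameters[OF \<epsilon>] by (auto simp: \<beta>_def \<delta>_def \<gamma>_def)
  have M: "M \<ge> 1" by (simp add: M_def)
  define b where "b = bconst \<epsilon>"
  have b: "b \<ge> 1" using \<epsilon> by (simp add: b_def bconst_def)
  \<comment> \<open>The condition on \<open>b\<close> ensures \<open>s \<ge> 1\<close>, and the one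
    on \<open>M\<close> ensures \<open>L \<ge> 1\<close>; the others control the tail and the two
    terms of the union bound.\<close>
  have "eventually (\<lambda>x::real. 25 \<le> x \<and> b \<le> x powr \<epsilon> \<and> M \<le> x powr (1 - \<epsilon>)
      \<and> tail_exponent \<beta> x \<le> \<delta> * ln x
      \<and> M\<^sup>2 * x powr M * exp (- ((x powr \<gamma> / M - 1) / sqrt (2 * pi))) \<le> exp (- (x powr \<epsilon>)) / 2
      \<and> M\<^sup>2 * x powr M * exp (- (x - 1) / 2) \<le> exp (- (x powr \<epsilon>)) / 2) at_top"
  proof (intro eventually_conj)
    show "eventually (\<lambda>x::real. 25 \<le> x) at_top" by (rule eventually_ge_at_top)
    show "eventually (\<lambda>x::real. b \<le> x powr \<epsilon>) at_top" using \<epsilon>(1) by real_asymp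
    have "1 - \<epsilon> > 0" using \<epsilon> by simp
    then show "eventually (\<lambda>x::real. M \<le> x powr (1 - \<epsilon>)) at_top" by real_asymp
    show "eventually (\<lambda>x. tail_exponent \<beta> x \<le> \<delta> * ln x) at_top"
      using par \<epsilon> by (intro tail_exponent_le) (auto simp: \<delta>_def)
    show "eventually (\<lambda>x. M\<^sup>2 * x powr M * exp (- ((x powr \<gamma> / M - 1) / sqrt (2 * pi)))
        \<le> exp (- (x powr \<epsilon>)) / 2) at_top"
      using par \<epsilon> M by (intro union_bound_group_term) auto
    show "eventually (\<lambda>x. M\<^sup>2 * x powr M * exp (- (x - 1) / 2) \<le> exp (- (x powr \<epsilon>)) / 2) at_top"
      using \<epsilon> M by (intro union_bound_common_term) auto
  qed
  then obtain x\<^sub>0 where x\<^sub>0: "\<And>x. x \<ge> x\<^sub>0 \<Longrightarrow> 25 \<le> x \<and> b \<le> x powr \<epsilon> \<and> M \<le> x powr (1 - \<epsilon>)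
      \<and> tail_exponent \<beta> x \<le> \<delta> * ln x
      \<and> M\<^sup>2 * x powr M * exp (- ((x powr \<gamma> / M - 1) / sqrt (2 * pi))) \<le> exp (- (x powr \<epsilon>)) / 2
      \<and> M\<^sup>2 * x powr M * exp (- (x - 1) / 2) \<le> exp (- (x powr \<epsilon>)) / 2"
    unfolding eventually_at_top_linorder by blast
  show ?thesis
  proof (intro exI[of _ "nat \<lceil>x\<^sub>0\<rceil>"] allI impI ballI)
    fix d x P assume "nat \<lceil>x\<^sub>0\<rceil> \<le> d" and x: "x \<in> hypercube d" and P: "gff_law d P"
    then have "x\<^sub>0 \<le> real d" by linarith
    note large = x\<^sub>0[OF this]
    have d: "d \<ge> 25" using large by linarith
    have d0: "real d > 0" using d by simp
    define s where "s = nat \<lfloor>real d powr \<epsilon> / b\<rfloor>"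
    define L where "L = d div (Suc m * s)"
    define h where "h = h_as d * (1 - 2 * \<epsilon>)"
    have fl: "\<lfloor>real d powr \<epsilon> / b\<rfloor> \<ge> 1" using large b by (simp add: le_floor_iff)
    then have s: "s \<ge> 1" "real s = of_int \<lfloor>real d powr \<epsilon> / b\<rfloor>"
      unfolding s_def by linarith+
    have "real s \<le> real d powr \<epsilon> / b" using s by linarith
    also have "\<dots> \<le> real d powr \<epsilon>" using divide_left_mono[OF b, of "real d powr \<epsilon>"] b by simp
    finally have s_le: "real s \<le> real d powr \<epsilon>" .
    have size: "Suc m * s * L \<le> d" unfolding L_def by (rule times_div_less_eq_dividend)
    have "real d powr (1 - \<epsilon>) / M - 1 = real d / (M * real d powr \<epsilon>) - 1"
      using d0 by (simp add: powr_diff)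
    also have "\<dots> \<le> real d / (M * real s) - 1"
      using s_le s(1) M d0 by (intro diff_mono divide_left_mono mult_left_mono mult_pos_pos) auto
    also have "\<dots> = real d / real (Suc m * s) - 1" by (simp only: M_def of_nat_mult)
    also have "\<dots> < real L"
    proof -
      define q where "q = Suc m * s"
      have q: "q > 0" using s(1) by (simp add: q_def)
      have "d < q + q * L"
        unfolding L_def q_def[symmetric] using q by (rule dividend_less_times_div)
      then have "real d < real (q + q * L)" by (simp only: of_nat_less_iff)
      then have "real d < real q * (real L + 1)" by (simp add: algebra_simps)
      then have "real d / real q < real L + 1" using q by (simp add: divide_less_eq mult.commute)
      then show ?thesis by (simp add: q_def)
    qed
    finally have L_gt: "real d powr (1 - \<epsilon>) / M - 1 < real L" .
    have L0: "real d powr (1 - \<epsilon>) / M - 1 \<ge> 0" using large M by simp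
    then have L: "L \<ge> 1" using L_gt by linarith
    have floor_le: "real_of_int \<lfloor>real d powr \<epsilon> / bconst \<epsilon>\<rfloor> powr (bconst \<epsilon> - 1) \<le> real (s ^ m)"
    proof -
      have "real_of_int \<lfloor>real d powr \<epsilon> / bconst \<epsilon>\<rfloor> powr (bconst \<epsilon> - 1) = real s powr (11 / \<epsilon>)"
        unfolding s(2) by (simp add: b_def bconst_def)
      also have "\<dots> \<le> real s powr real m"
        using s(1) by (intro powr_mono) (auto simp: m_def, linarith)
      also have "\<dots> = real (s ^ m)" using s(1) by (simp add: powr_realpow)
      finally show ?thesis .
    qed
    have h: "h \<ge> 0" "h \<le> sqrt (2 * (1 + 1 / (real d - 1)) * ln (real d)) * \<beta>"
      using h_as_bounds[OF d] par by (auto simp: h_def \<beta>_def[symmetric] intro: mult_right_mono)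
    let ?w = "(h + 1) / sqrt (1 - 1 / (real d - 1)) + 1"
    have "?w\<^sup>2 / 2 \<le> tail_exponent \<beta> (real d)"
      unfolding tail_exponent_def using h d
      by (intro divide_right_mono power_mono add_right_mono) (auto intro!: add_nonneg_nonneg divide_nonneg_nonneg)
    also have "\<dots> \<le> \<delta> * ln (real d)" using large by blast
    finally have "exp (- (\<delta> * ln (real d))) \<le> exp (- ?w\<^sup>2 / 2)" by simp
    then have q: "real d powr (-\<delta>) \<le> exp (- ?w\<^sup>2 / 2)" using d0 by (simp add: powr_def)
    have "real d powr (-\<delta>) \<le> real d powr 0" using d par by (intro powr_mono) auto
    then have small: "real d powr (-\<delta>) \<le> 1" using d0 by simp
    \<comment> \<open>The expected number of exceedances in an interval is of order
      \<open>d powr \<gamma>\<close>; since \<open>d powr (-\<delta>)\<close> is at most 1, the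
      rounding loss in \<open>L\<close> costs at most the same additive 1.\<close>
    have "real d powr \<gamma> = real d powr (1 - \<epsilon>) * real d powr (-\<delta>)"
      by (simp add: \<gamma>_def flip: powr_add)
    then have "real d powr \<gamma> / M - 1 \<le> (real d powr (1 - \<epsilon>) / M - 1) * real d powr (-\<delta>)"
      using small by (simp only: left_diff_distrib times_divide_eq_left)
    also have "\<dots> \<le> real L * exp (- ?w\<^sup>2 / 2)"
      using L0 L_gt q by (intro mult_mono) auto
    finally have "(real d powr \<gamma> / M - 1) / sqrt (2 * pi) \<le> real L * exp (- ?w\<^sup>2 / 2) / sqrt (2 * pi)"
      by (intro divide_right_mono) auto
    then have e1: "exp (- (real L * (exp (- ?w\<^sup>2 / 2) / sqrt (2 * pi))))
        \<le> exp (- ((real d powr \<gamma> / M - 1) / sqrt (2 * pi)))" by simp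
    have "real d powr \<epsilon> \<le> real d powr 1" using d \<epsilon> by (intro powr_mono) auto
    then have "real s \<le> real d" using s_le d0 by simp
    then have "real ((Suc m)\<^sup>2 * d ^ m * s) \<le> M\<^sup>2 * real d ^ m * real d"
      unfolding of_nat_mult of_nat_power M_def by (intro mult_left_mono) auto
    also have "\<dots> = M\<^sup>2 * real d powr M"
      using d0 unfolding M_def by (subst powr_realpow) (auto simp: mult_ac)
    finally have card: "real ((Suc m)\<^sup>2 * d ^ m * s) \<le> M\<^sup>2 * real d powr M" .
    have "1 - measure P {\<omega> \<in> space P. \<exists>y. nbr x y \<and>
          (\<exists>C. y \<in> C \<and> substantial_comp \<epsilon> d (hypercube d \<inter> level_set \<omega> d h) C)}
        \<le> real ((Suc m)\<^sup>2 * d ^ m * s) *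
          (exp (- (real L * (exp (- ?w\<^sup>2 / 2) / sqrt (2 * pi)))) + exp (- (real d - 1) / 2))"
      by (rule prob_no_substantial_le[OF P x d h(1) s(1) L size floor_le])
    also have "\<dots> \<le> M\<^sup>2 * real d powr M *
        (exp (- ((real d powr \<gamma> / M - 1) / sqrt (2 * pi))) + exp (- (real d - 1) / 2))"
      using card e1 by (intro mult_mono) auto
    also have "\<dots> \<le> exp (- (real d powr \<epsilon>))"
      using large unfolding distrib_left by linarith
    finally show "1 - exp (- (real d powr \<epsilon>)) \<le> measure P {\<omega> \<in> space P. \<exists>y. nbr x y \<and>
          (\<exists>C. y \<in> C \<and> substantial_comp \<epsilon> d
                 (hypercube d \<inter> level_set \<omega> d (h_as d * (1 - 2 * \<epsilon>))) C)}"
      unfolding h_def by linarith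
  qed
qed

theorem theorem4p4:
  fixes \<epsilon> :: real
  assumes "0 < \<epsilon>" and "\<epsilon> < 1/3"
  shows "\<exists>c c'. c > 0 \<and> c' > 0 \<and>
    (\<forall>d::nat. d \<ge> 3 \<longrightarrow> (\<forall>x \<in> hypercube d. \<forall>P. gff_law d P \<longrightarrow>
      measure P {\<omega> \<in> space P. \<exists>y. nbr x y \<and>
          (\<exists>C. y \<in> C \<and> substantial_comp \<epsilon> d
                 (hypercube d \<inter> level_set \<omega> d (h_as d * (1 - 2 * \<epsilon>))) C)}
        \<ge> 1 - c * exp (- c' * real d powr \<epsilon>)))"
proof -
  obtain d\<^sub>0 where d\<^sub>0: "\<And>d x P. d \<ge> d\<^sub>0 \<Longrightarrow> x \<in> hypercube d \<Longrightarrow> gff_law d P \<Longrightarrow>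
      1 - exp (- (real d powr \<epsilon>)) \<le> measure P {\<omega> \<in> space P. \<exists>y. nbr x y \<and>
          (\<exists>C. y \<in> C \<and> substantial_comp \<epsilon> d
                 (hypercube d \<inter> level_set \<omega> d (h_as d * (1 - 2 * \<epsilon>))) C)}"
    using substantial_large_d[OF assms] by blast
  \<comment> \<open>With \<open>c' = 1\<close>, this constant makes the lower bound nonpositive for
    every dimension below \<open>d\<^sub>0\<close>.\<close>
  define c where "c = exp (real d\<^sub>0 powr \<epsilon>)"
  have c: "c \<ge> 1" by (simp add: c_def)
  show ?thesis
  proof (rule exI[of _ c], rule exI[of _ 1], intro conjI allI impI ballI)
    fix d :: nat and x P
    assume x: "x \<in> hypercube d" and P: "gff_law d P"
    let ?p = "measure P {\<omega> \<in> space P. \<exists>y. nbr x y \<and>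
          (\<exists>C. y \<in> C \<and> substantial_comp \<epsilon> d
                 (hypercube d \<inter> level_set \<omega> d (h_as d * (1 - 2 * \<epsilon>))) C)}"
    show "1 - c * exp (- 1 * real d powr \<epsilon>) \<le> ?p"
    proof (cases "d\<^sub>0 \<le> d")
      case True
      have "exp (- 1 * real d powr \<epsilon>) \<le> c * exp (- 1 * real d powr \<epsilon>)"
        using mult_right_mono[OF c, of "exp (- 1 * real d powr \<epsilon>)"] by simp
      then show ?thesis using d\<^sub>0[OF True x P] by (simp only: mult_minus1)
    next
      case False
      then have "real d powr \<epsilon> \<le> real d\<^sub>0 powr \<epsilon>" using assms by (intro powr_mono2) auto
      then have "1 \<le> c * exp (- 1 * real d powr \<epsilon>)" by (simp add: c_def flip: exp_add)
      moreover have "?p \<ge> 0" by simp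
      ultimately show ?thesis by linarith
    qed
  qed (use c in auto)
qed

end
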